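(* Every pairwise Hausdorff bispace is bisober.
   Context: A bispace is a set $X$ with two topologies $\Omega^+(X),\Omega^-(X)$ (positive and negative opens). $X$ is pairwise Hausdorff if whenever $x,y\in X$ with $x\ne y$, there are disjoint $U^+\in\Omega^+(X)$ and $U^-\in\Omega^-(X)$ such that $x\in U^+$ and $y\in U^-$, or there are disjoint $U^+\in\Omega^+(X)$ and $U^-\in\Omega^-(X)$ such that $y\in U^+$ and $x\in U^-$. A biframe is a triple $\mathcal L=(L^+,L^-,L)$ of frames with injective frame maps $e_L^{\pm}:L^{\pm}\to L$ such that every element of $L$ is a join of elements $e_L^+(x^+)\wedge e_L^-(x^-)$. A biframe map $(f^+,f^-):\mathcal L\to\mathcal M$ is a pair of frame maps $f^{\pm}:L^{\pm}\to M^{\pm}$ for which there is a frame map $f:L\to M$ with $f\circ e_L^{\pm}=e_M^{\pm}\circ f^{\pm}$. $\mathsf{bpt}(\mathcal L)$ is the bispace of biframe maps $\mathcal L\to(2,2,2)$ with positive opens $\{f:f^+(a^+)=1\}$ ($a^+\in L^+$) and negative opens $\{f:f^-(a^-)=1\}$ ($a^-\in L^-$). $\mathsf{b}\Omega_{\mathsf{fin}}(X)$ is the biframe $(\Omega^+(X),\Omega^-(X),\Omega_{\mathsf{fin}}(X))$, with $\Omega_{\mathsf{fin}}(X)$ the quotient of the frame coproduct $\Omega^+(X)\oplus\Omega^-(X)$ imposing the inequalities $\ulcorner U^+\urcorner\wedge \ulcorner U^-\urcorner\le \ulcorner V^+\urcorner\vee \ulcorner V^-\urcorner$ whenever $U^+\cap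 U^-\subseteq V^+\cup V^-$ in $X$ (here $\ulcorner-\urcorner$ are the coproduct injections). $X$ is bisober if the map $X\to\mathsf{bpt}(\mathsf{b}\Omega_{\mathsf{fin}}(X))$, $x\mapsto(N_x^+,N_x^-)$ with $N_x^{\pm}(U)=1$ iff $x\in U$, is a bihomeomorphism, i.e. a bijection that is a homeomorphism for both the positive and the negative topologies. *)

theory Defs
  imports "HOL-Analysis.Abstract_Topology" "HOL-Algebra.Complete_Lattice"
begin

section \<open>Frames\<close>

locale frame = complete_lattice +
  assumes meet_sup_distrib:
    "\<lbrakk>a \<in> carrier L; A \<subseteq> carrier L\<rbrakk> \<Longrightarrow> a \<sqinter> (\<Squnion>A) = \<Squnion>((\<lambda>x. a \<sqinter> x) ` A)"

definition frame_map ::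
    "('a, 'c) gorder_scheme \<Rightarrow> ('b, 'd) gorder_scheme \<Rightarrow> ('a \<Rightarrow> 'b) \<Rightarrow> bool" where
  "frame_map L M f \<longleftrightarrow>
     f \<in> carrier L \<rightarrow> carrier M \<and> sup_pres L M f \<and> meet_pres L M f \<and> f \<top>\<^bsub>L\<^esub> = \<top>\<^bsub>M\<^esub>"

definition two_frame :: "bool gorder" where
  "two_frame = \<lparr>carrier = UNIV, eq = (=), le = (\<le>)\<rparr>"

definition open_frame :: "'a topology \<Rightarrow> 'a set gorder" where
  "open_frame T = \<lparr>carrier = {U. openin T U}, eq = (=), le = (\<subseteq>)\<rparr>"

subsection \<open>Basic facts\<close>

lemma is_lub_imp_sup:
  fixes L (structure)
  assumes "complete_lattice L" "A \<subseteq> carrier L" "x \<in> carrier L"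
    and "\<And>a. a \<in> A \<Longrightarrow> a \<sqsubseteq>\<^bsub>L\<^esub> x"
    and "\<And>u. \<lbrakk>u \<in> carrier L; \<forall>a\<in>A. a \<sqsubseteq>\<^bsub>L\<^esub> u\<rbrakk> \<Longrightarrow> x \<sqsubseteq>\<^bsub>L\<^esub> u"
  shows "\<Squnion>\<^bsub>L\<^esub>A = x"
proof -
  interpret complete_lattice L by fact
  show ?thesis
  proof (rule le_antisym)
    show "\<Squnion>A \<sqsubseteq> x" using assms(2-4) by (rule weak.sup_least)
    show "x \<sqsubseteq> \<Squnion>A"
      by (rule assms(5)) (simp_all add: assms(2) weak.sup_upper)
  qed (simp_all add: assms(2,3))
qed

lemma is_glb_imp_meet:
  fixes L (structure)
  assumes "complete_lattice L" "a \<in> carrier L" "b \<in> carrier L" "x \<in> carrier L"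
    and "x \<sqsubseteq>\<^bsub>L\<^esub> a" "x \<sqsubseteq>\<^bsub>L\<^esub> b"
    and "\<And>u. \<lbrakk>u \<in> carrier L; u \<sqsubseteq>\<^bsub>L\<^esub> a; u \<sqsubseteq>\<^bsub>L\<^esub> b\<rbrakk> \<Longrightarrow> u \<sqsubseteq>\<^bsub>L\<^esub> x"
  shows "a \<sqinter>\<^bsub>L\<^esub> b = x"
proof -
  interpret complete_lattice L by fact
  show ?thesis
  proof (rule le_antisym)
    show "a \<sqinter> b \<sqsubseteq> x"
      by (rule assms(7)) (simp_all add: assms(2,3) meet_left meet_right)
    show "x \<sqsubseteq> a \<sqinter> b" by (rule meet_le) (simp_all add: assms)
  qed (simp_all add: assms(2-4))
qed

lemma is_greatest_imp_top:
  assumes "complete_lattice L" "x \<in> carrier L" "\<And>u. u \<in> carrier L \<Longrightarrow> u \<sqsubseteq>\<^bsub>L\<^esub> x"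
  shows "\<top>\<^bsub>L\<^esub> = x"
proof -
  interpret complete_lattice L by fact
  show ?thesis by (rule le_antisym) (simp_all add: assms(2,3))
qed

lemma is_least_imp_bottom:
  assumes "complete_lattice L" "x \<in> carrier L" "\<And>u. u \<in> carrier L \<Longrightarrow> x \<sqsubseteq>\<^bsub>L\<^esub> u"
  shows "\<bottom>\<^bsub>L\<^esub> = x"
proof -
  interpret complete_lattice L by fact
  show ?thesis by (rule le_antisym) (simp_all add: assms(2,3))
qed

lemma frame_criterion:
  fixes L (structure)
  assumes po: "partial_order L"
    and S: "\<And>A. A \<subseteq> carrier L \<Longrightarrow> S A \<in> carrier L"
      "\<And>A a. \<lbrakk>A \<subseteq> carrier L; a \<in> A\<rbrakk> \<Longrightarrow> a \<sqsubseteq> S A"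
      "\<And>A u. \<lbrakk>A \<subseteq> carrier L; u \<in> carrier L; \<forall>a\<in>A. a \<sqsubseteq> u\<rbrakk> \<Longrightarrow> S A \<sqsubseteq> u"
    and m: "\<And>a b. \<lbrakk>a \<in> carrier L; b \<in> carrier L\<rbrakk> \<Longrightarrow> m a b \<in> carrier L"
      "\<And>a b. \<lbrakk>a \<in> carrier L; b \<in> carrier L\<rbrakk> \<Longrightarrow> m a b \<sqsubseteq> a"
      "\<And>a b. \<lbrakk>a \<in> carrier L; b \<in> carrier L\<rbrakk> \<Longrightarrow> m a b \<sqsubseteq> b"
      "\<And>a b u. \<lbrakk>a \<in> carrier L; b \<in> carrier L; u \<in> carrier L; u \<sqsubseteq> a; u \<sqsubseteq> b\<rbrakk> \<Longrightarrow> u \<sqsubseteq> m a b"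
    and distrib: "\<And>a A. \<lbrakk>a \<in> carrier L; A \<subseteq> carrier L\<rbrakk> \<Longrightarrow> m a (S A) \<sqsubseteq> S (m a ` A)"
  shows "frame L"
    and "\<And>A. A \<subseteq> carrier L \<Longrightarrow> \<Squnion>A = S A"
    and "\<And>a b. \<lbrakk>a \<in> carrier L; b \<in> carrier L\<rbrakk> \<Longrightarrow> a \<sqinter> b = m a b"
proof -
  interpret partial_order L by fact
  have lub: "is_lub L (S A) A" if "A \<subseteq> carrier L" for A
  proof (rule least_UpperI)
    fix y assume "y \<in> Upper L A"
    then show "S A \<sqsubseteq> y" using that by (intro S(3)) (auto simp: Upper_def)
  qed (use that S in auto)
  interpret complete_lattice L
  proof
    fix A assume A: "A \<subseteq> carrier L"
    show "\<exists>s. is_lub L s A" using lub[OF A] by blast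
    have "is_glb L (S (Lower L A)) A"
    proof (rule greatest_LowerI)
      fix x assume "x \<in> A"
      then show "S (Lower L A) \<sqsubseteq> x" using A by (intro S(3)) (auto simp: Lower_def)
    next
      fix y assume "y \<in> Lower L A"
      then show "y \<sqsubseteq> S (Lower L A)" by (intro S(2)) auto
    qed (use A S in auto)
    then show "\<exists>s. is_glb L s A" by blast
  qed
  have cl: "complete_lattice L" by unfold_locales
  show sup: "\<Squnion>A = S A" if "A \<subseteq> carrier L" for A
    by (rule is_lub_imp_sup[OF cl that S(1)[OF that]]) (use that S in auto)
  show meet: "a \<sqinter> b = m a b" if "a \<in> carrier L" "b \<in> carrier L" for a b
    by (rule is_glb_imp_meet[OF cl that m(1)[OF that]]) (use that m in auto)
  show "frame L"
  proof
    fix a A assume a: "a \<in> carrier L" and A: "A \<subseteq> carrier L"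
    have im: "m a ` A \<subseteq> carrier L" using a A m(1) by auto
    have im': "(\<lambda>x. a \<sqinter> x) ` A = m a ` A"
      by (rule image_cong) (use a A meet in auto)
    show "a \<sqinter> \<Squnion>A = \<Squnion>((\<lambda>x. a \<sqinter> x) ` A)"
      unfolding im' sup[OF A] sup[OF im] meet[OF a S(1)[OF A]]
    proof (rule le_antisym)
      show "m a (S A) \<sqsubseteq> S (m a ` A)" using a A by (rule distrib)
      show "S (m a ` A) \<sqsubseteq> m a (S A)"
      proof (rule S(3)[OF im]; (intro ballI)?)
        fix y assume "y \<in> m a ` A"
        then obtain x where x: "x \<in> A" "y = m a x" by blast
        have c: "x \<in> carrier L" "S A \<in> carrier L" using x A S(1) by auto
        have "m a x \<sqsubseteq> S A"
          using m(1,3)[OF a c(1)] S(2)[OF A x(1)] c by (rule_tac le_trans[of _ x]) auto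
        then show "y \<sqsubseteq> m a (S A)"
          unfolding x(2) by (intro m(4) m(1,2) a c)
      qed (use a A m S in auto)
    qed (use a A im m S in auto)
  qed
qed

lemma frame_mapI:
  assumes "frame L" "frame M" "\<And>x. x \<in> carrier L \<Longrightarrow> f x \<in> carrier M"
    and "\<And>A. A \<subseteq> carrier L \<Longrightarrow> f (\<Squnion>\<^bsub>L\<^esub>A) = \<Squnion>\<^bsub>M\<^esub>(f ` A)"
    and "\<And>x y. \<lbrakk>x \<in> carrier L; y \<in> carrier L\<rbrakk> \<Longrightarrow> f (x \<sqinter>\<^bsub>L\<^esub> y) = f x \<sqinter>\<^bsub>M\<^esub> f y"
    and "f \<top>\<^bsub>L\<^esub> = \<top>\<^bsub>M\<^esub>"
  shows "frame_map L M f"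
  using assms by (auto simp: frame_map_def sup_pres_def meet_pres_def frame_def)

lemma frame_mapD:
  assumes "frame_map L M f"
  shows "x \<in> carrier L \<Longrightarrow> f x \<in> carrier M"
    and "A \<subseteq> carrier L \<Longrightarrow> f (\<Squnion>\<^bsub>L\<^esub>A) = \<Squnion>\<^bsub>M\<^esub>(f ` A)"
    and "\<lbrakk>x \<in> carrier L; y \<in> carrier L\<rbrakk> \<Longrightarrow> f (x \<sqinter>\<^bsub>L\<^esub> y) = f x \<sqinter>\<^bsub>M\<^esub> f y"
    and "f \<top>\<^bsub>L\<^esub> = \<top>\<^bsub>M\<^esub>"
  using assms by (auto simp: frame_map_def sup_pres_def meet_pres_def)

lemma frame_map_join:
  assumes "frame_map L M f" "x \<in> carrier L" "y \<in> carrier L"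
  shows "f (x \<squnion>\<^bsub>L\<^esub> y) = f x \<squnion>\<^bsub>M\<^esub> f y"
  using frame_mapD(2)[OF assms(1), of "{x, y}"] assms by (simp add: join_def)

lemma frame_map_comp:
  assumes "frame_map L M f" "frame_map M N g" "frame L" "frame N"
  shows "frame_map L N (g \<circ> f)"
proof (rule frame_mapI)
  fix A assume A: "A \<subseteq> carrier L"
  then have "f ` A \<subseteq> carrier M" using frame_mapD(1)[OF assms(1)] by auto
  then show "(g \<circ> f) (\<Squnion>\<^bsub>L\<^esub>A) = \<Squnion>\<^bsub>N\<^esub>((g \<circ> f) ` A)"
    using A frame_mapD(2)[OF assms(1)] frame_mapD(2)[OF assms(2)] by (simp add: image_comp)
qed (simp_all add: assms frame_mapD[OF assms(1)] frame_mapD[OF assms(2)])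

lemma (in frame) le_iff_meet:
  "\<lbrakk>x \<in> carrier L; y \<in> carrier L\<rbrakk> \<Longrightarrow> x \<sqsubseteq> y \<longleftrightarrow> x \<sqinter> y = x"
  using is_glb_imp_meet[OF complete_lattice_axioms, of x y x] meet_right[of x y] by auto

lemma frame_map_mono:
  assumes "frame_map L M f" "frame L" "frame M" "x \<in> carrier L" "y \<in> carrier L" "x \<sqsubseteq>\<^bsub>L\<^esub> y"
  shows "f x \<sqsubseteq>\<^bsub>M\<^esub> f y"
  using assms(4-6) frame.le_iff_meet[OF assms(2)] frame.le_iff_meet[OF assms(3)]
    frame_mapD(1,3)[OF assms(1)] by (metis (no_types))

lemma frame_two_frame: "frame two_frame"
  and sup_two_frame: "\<Squnion>\<^bsub>two_frame\<^esub> A \<longleftrightarrow> (\<exists>b\<in>A. b)"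
  and meet_two_frame: "a \<sqinter>\<^bsub>two_frame\<^esub> b \<longleftrightarrow> a \<and> b"
proof -
  have po: "partial_order two_frame"
    by unfold_locales (auto simp: two_frame_def)
  note c = frame_criterion[OF po, of "\<lambda>A. \<exists>b\<in>A. b" "(\<and>)"]
  show "frame two_frame" by (rule c) (auto simp: two_frame_def)
  show "\<Squnion>\<^bsub>two_frame\<^esub> A \<longleftrightarrow> (\<exists>b\<in>A. b)" by (rule c) (auto simp: two_frame_def)
  show "a \<sqinter>\<^bsub>two_frame\<^esub> b \<longleftrightarrow> a \<and> b" by (rule c) (auto simp: two_frame_def)
qed

lemma top_two_frame: "\<top>\<^bsub>two_frame\<^esub>"
  using is_greatest_imp_top[of two_frame True] frame_two_frame
  by (auto simp: frame_def two_frame_def)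

lemma frame_open_frame: "frame (open_frame T)"
  and sup_open_frame: "A \<subseteq> carrier (open_frame T) \<Longrightarrow> \<Squnion>\<^bsub>open_frame T\<^esub> A = \<Union>A"
  and meet_open_frame:
    "\<lbrakk>openin T U; openin T V\<rbrakk> \<Longrightarrow> U \<sqinter>\<^bsub>open_frame T\<^esub> V = U \<inter> V"
proof -
  have po: "partial_order (open_frame T)"
    by unfold_locales (auto simp: open_frame_def)
  note c = frame_criterion[OF po, of Union "(\<inter>)"]
  show "frame (open_frame T)" by (rule c) (auto simp: open_frame_def)
  show "\<Squnion>\<^bsub>open_frame T\<^esub> A = \<Union>A" if "A \<subseteq> carrier (open_frame T)"
    by (rule c) (use that in \<open>auto simp: open_frame_def\<close>)
  show "U \<sqinter>\<^bsub>open_frame T\<^esub> V = U \<inter> V" if "openin T U" "openin T V"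
    by (rule c) (use that in \<open>auto simp: open_frame_def\<close>)
qed

lemma top_open_frame: "\<top>\<^bsub>open_frame T\<^esub> = topspace T"
  by (rule is_greatest_imp_top)
    (use frame_open_frame in \<open>auto simp: frame_def open_frame_def openin_subset\<close>)

subsection \<open>Coproducts of frames\<close>

text \<open>The coproduct of two frames is realised by the usual concrete construction: its elements are
  the down-sets of the product that are closed under joins in each coordinate separately.
  The universal property is \<open>frame_coproduct_universal\<close> below. The empty join is included,
  so every such set contains all pairs with a bottom coordinate.\<close>

definition coproduct_ideal ::
    "('a, 'c) gorder_scheme \<Rightarrow> ('b, 'd) gorder_scheme \<Rightarrow> ('a \<times> 'b) set \<Rightarrow> bool" where
  "coproduct_ideal L M I \<longleftrightarrow>
     I \<subseteq> carrier L \<times> carrier M \<and>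
     (\<forall>(a, b) \<in> I. \<forall>x \<in> carrier L. \<forall>y \<in> carrier M. x \<sqsubseteq>\<^bsub>L\<^esub> a \<longrightarrow> y \<sqsubseteq>\<^bsub>M\<^esub> b \<longrightarrow> (x, y) \<in> I) \<and>
     (\<forall>A \<subseteq> carrier L. \<forall>b \<in> carrier M. A \<times> {b} \<subseteq> I \<longrightarrow> (\<Squnion>\<^bsub>L\<^esub>A, b) \<in> I) \<and>
     (\<forall>a \<in> carrier L. \<forall>B \<subseteq> carrier M. {a} \<times> B \<subseteq> I \<longrightarrow> (a, \<Squnion>\<^bsub>M\<^esub>B) \<in> I)"

definition frame_coproduct ::
    "('a, 'c) gorder_scheme \<Rightarrow> ('b, 'd) gorder_scheme \<Rightarrow> ('a \<times> 'b) set gorder" where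
  "frame_coproduct L M = \<lparr>carrier = {I. coproduct_ideal L M I}, eq = (=), le = (\<subseteq>)\<rparr>"

text \<open>The injections send \<open>a\<close> and \<open>b\<close> to the least elements of the coproduct
  containing \<open>(a, \<top>)\<close> and \<open>(\<top>, b)\<close>.\<close>

definition coproduct_inl ::
    "('a, 'c) gorder_scheme \<Rightarrow> ('b, 'd) gorder_scheme \<Rightarrow> 'a \<Rightarrow> ('a \<times> 'b) set" where
  "coproduct_inl L M a = {(x, y) \<in> carrier L \<times> carrier M. x \<sqsubseteq>\<^bsub>L\<^esub> a \<or> y = \<bottom>\<^bsub>M\<^esub>}"

definition coproduct_inr ::
    "('a, 'c) gorder_scheme \<Rightarrow> ('b, 'd) gorder_scheme \<Rightarrow> 'b \<Rightarrow> ('a \<times> 'b) set" where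
  "coproduct_inr L M b = {(x, y) \<in> carrier L \<times> carrier M. x = \<bottom>\<^bsub>L\<^esub> \<or> y \<sqsubseteq>\<^bsub>M\<^esub> b}"

subsection \<open>Quotients of frames\<close>

definition frame_congruence :: "('a, 'c) gorder_scheme \<Rightarrow> ('a \<times> 'a) set \<Rightarrow> bool" where
  "frame_congruence L r \<longleftrightarrow>
     equiv (carrier L) r \<and>
     (\<forall>(a, b) \<in> r. \<forall>(c, d) \<in> r. (a \<sqinter>\<^bsub>L\<^esub> c, b \<sqinter>\<^bsub>L\<^esub> d) \<in> r) \<and>
     (\<forall>S \<subseteq> r. (\<Squnion>\<^bsub>L\<^esub>(fst ` S), \<Squnion>\<^bsub>L\<^esub>(snd ` S)) \<in> r)"

text \<open>A pair \<open>(a, b)\<close> in \<open>R\<close> stands for the inequality \<open>a \<le> b\<close>, that is, for the identification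
  of \<open>a \<sqinter> b\<close> with \<open>a\<close>.\<close>

definition imposed_congruence ::
    "('a, 'c) gorder_scheme \<Rightarrow> ('a \<times> 'a) set \<Rightarrow> ('a \<times> 'a) set" where
  "imposed_congruence L R = \<Inter>{r. frame_congruence L r \<and> (\<forall>(a, b) \<in> R. (a \<sqinter>\<^bsub>L\<^esub> b, a) \<in> r)}"

definition frame_quotient ::
    "('a, 'c) gorder_scheme \<Rightarrow> ('a \<times> 'a) set \<Rightarrow> 'a set gorder" where
  "frame_quotient L r =
     \<lparr>carrier = carrier L // r, eq = (=), le = (\<lambda>A B. \<exists>a \<in> A. \<exists>b \<in> B. a \<sqsubseteq>\<^bsub>L\<^esub> b)\<rparr>"

subsection \<open>The coproduct\<close>

locale two_frames = l: frame L + m: frame M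
  for L :: "('a, 'c) gorder_scheme" and M :: "('b, 'd) gorder_scheme"
begin

lemma coproduct_idealD:
  assumes "coproduct_ideal L M I"
  shows "I \<subseteq> carrier L \<times> carrier M"
    and "\<lbrakk>(a, b) \<in> I; x \<in> carrier L; y \<in> carrier M; x \<sqsubseteq>\<^bsub>L\<^esub> a; y \<sqsubseteq>\<^bsub>M\<^esub> b\<rbrakk> \<Longrightarrow> (x, y) \<in> I"
    and "\<lbrakk>A \<subseteq> carrier L; b \<in> carrier M; \<And>a. a \<in> A \<Longrightarrow> (a, b) \<in> I\<rbrakk> \<Longrightarrow> (\<Squnion>\<^bsub>L\<^esub>A, b) \<in> I"
    and "\<lbrakk>a \<in> carrier L; B \<subseteq> carrier M; \<And>b. b \<in> B \<Longrightarrow> (a, b) \<in> I\<rbrakk> \<Longrightarrow> (a, \<Squnion>\<^bsub>M\<^esub>B) \<in> I"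
proof -
  note d = assms[unfolded coproduct_ideal_def]
  show "I \<subseteq> carrier L \<times> carrier M" using d by (rule conjunct1)
  show "(x, y) \<in> I"
    if "(a, b) \<in> I" "x \<in> carrier L" "y \<in> carrier M" "x \<sqsubseteq>\<^bsub>L\<^esub> a" "y \<sqsubseteq>\<^bsub>M\<^esub> b"
    using bspec[OF conjunct1[OF conjunct2[OF d]] that(1)] that(2-) by simp
  show "(\<Squnion>\<^bsub>L\<^esub>A, b) \<in> I" if "A \<subseteq> carrier L" "b \<in> carrier M" "\<And>a. a \<in> A \<Longrightarrow> (a, b) \<in> I"
    by (rule conjunct1[OF conjunct2[OF conjunct2[OF d]], rule_format]) (use that in auto)
  show "(a, \<Squnion>\<^bsub>M\<^esub>B) \<in> I" if "a \<in> carrier L" "B \<subseteq> carrier M" "\<And>b. b \<in> B \<Longrightarrow> (a, b) \<in> I"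
    by (rule conjunct2[OF conjunct2[OF conjunct2[OF d]], rule_format]) (use that in auto)
qed

lemma coproduct_idealI:
  assumes "I \<subseteq> carrier L \<times> carrier M"
    and "\<And>a b x y. \<lbrakk>(a, b) \<in> I; x \<in> carrier L; y \<in> carrier M; x \<sqsubseteq>\<^bsub>L\<^esub> a; y \<sqsubseteq>\<^bsub>M\<^esub> b\<rbrakk> \<Longrightarrow> (x, y) \<in> I"
    and "\<And>A b. \<lbrakk>A \<subseteq> carrier L; b \<in> carrier M; \<And>a. a \<in> A \<Longrightarrow> (a, b) \<in> I\<rbrakk> \<Longrightarrow> (\<Squnion>\<^bsub>L\<^esub>A, b) \<in> I"
    and "\<And>a B. \<lbrakk>a \<in> carrier L; B \<subseteq> carrier M; \<And>b. b \<in> B \<Longrightarrow> (a, b) \<in> I\<rbrakk> \<Longrightarrow> (a, \<Squnion>\<^bsub>M\<^esub>B) \<in> I"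
  shows "coproduct_ideal L M I"
  unfolding coproduct_ideal_def
proof (intro conjI allI impI ballI)
  show "I \<subseteq> carrier L \<times> carrier M" by fact
  show "case p of (a, b) \<Rightarrow> \<forall>x\<in>carrier L. \<forall>y\<in>carrier M. x \<sqsubseteq>\<^bsub>L\<^esub> a \<longrightarrow> y \<sqsubseteq>\<^bsub>M\<^esub> b \<longrightarrow> (x, y) \<in> I"
    if "p \<in> I" for p
    using that assms(2) by (cases p) simp
  show "(\<Squnion>\<^bsub>L\<^esub>A, b) \<in> I" if "A \<subseteq> carrier L" "b \<in> carrier M" "A \<times> {b} \<subseteq> I" for A b
    using that by (intro assms(3)) auto
  show "(a, \<Squnion>\<^bsub>M\<^esub>B) \<in> I" if "a \<in> carrier L" "B \<subseteq> carrier M" "{a} \<times> B \<subseteq> I" for a B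
    using that by (intro assms(4)) auto
qed

lemma coproduct_ideal_bottom:
  assumes "coproduct_ideal L M I"
  shows "a \<in> carrier L \<Longrightarrow> (a, \<bottom>\<^bsub>M\<^esub>) \<in> I" "b \<in> carrier M \<Longrightarrow> (\<bottom>\<^bsub>L\<^esub>, b) \<in> I"
  using coproduct_idealD(3)[OF assms, of "{}" b] coproduct_idealD(4)[OF assms, of a "{}"]
    l.weak.weak_sup_empty m.weak.weak_sup_empty l.eq_is_equal m.eq_is_equal by auto

definition generated :: "('a \<times> 'b) set set \<Rightarrow> ('a \<times> 'b) set" where
  "generated \<I> = \<Inter>{I. coproduct_ideal L M I \<and> \<Union>\<I> \<subseteq> I}"

lemma coproduct_ideal_Times: "coproduct_ideal L M (carrier L \<times> carrier M)"
  by (rule coproduct_idealI) auto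

lemma coproduct_ideal_Int:
  assumes I: "coproduct_ideal L M I" and J: "coproduct_ideal L M J"
  shows "coproduct_ideal L M (I \<inter> J)"
proof (rule coproduct_idealI)
  show "I \<inter> J \<subseteq> carrier L \<times> carrier M" using coproduct_idealD(1)[OF I] by (rule le_infI1)
next
  fix a b x y
  assume "(a, b) \<in> I \<inter> J" "x \<in> carrier L" "y \<in> carrier M" "x \<sqsubseteq>\<^bsub>L\<^esub> a" "y \<sqsubseteq>\<^bsub>M\<^esub> b"
  then show "(x, y) \<in> I \<inter> J"
    using coproduct_idealD(2)[OF I, of a b x y] coproduct_idealD(2)[OF J, of a b x y] by simp
qed (simp_all add: coproduct_idealD(3,4)[OF I] coproduct_idealD(3,4)[OF J])

lemma generated_least:
  "\<lbrakk>coproduct_ideal L M J; \<And>I. I \<in> \<I> \<Longrightarrow> I \<subseteq> J\<rbrakk> \<Longrightarrow> generated \<I> \<subseteq> J"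
  unfolding generated_def by blast

lemma generated_upper: "I \<in> \<I> \<Longrightarrow> I \<subseteq> generated \<I>"
  unfolding generated_def by blast

lemma coproduct_ideal_generated:
  assumes "\<And>I. I \<in> \<I> \<Longrightarrow> coproduct_ideal L M I"
  shows "coproduct_ideal L M (generated \<I>)"
proof (rule coproduct_idealI)
  show "generated \<I> \<subseteq> carrier L \<times> carrier M"
    using assms by (intro generated_least coproduct_ideal_Times) (auto dest: coproduct_idealD(1))
next
  fix a b x y
  assume "(a, b) \<in> generated \<I>" "x \<in> carrier L" "y \<in> carrier M" "x \<sqsubseteq>\<^bsub>L\<^esub> a" "y \<sqsubseteq>\<^bsub>M\<^esub> b"
  then show "(x, y) \<in> generated \<I>"
    unfolding generated_def using coproduct_idealD(2)[of _ a b x y] by simp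
next
  fix A b assume "A \<subseteq> carrier L" "b \<in> carrier M" "\<And>a. a \<in> A \<Longrightarrow> (a, b) \<in> generated \<I>"
  then show "(\<Squnion>\<^bsub>L\<^esub>A, b) \<in> generated \<I>"
    unfolding generated_def using coproduct_idealD(3)[of _ A b] by simp
next
  fix a B assume "a \<in> carrier L" "B \<subseteq> carrier M" "\<And>b. b \<in> B \<Longrightarrow> (a, b) \<in> generated \<I>"
  then show "(a, \<Squnion>\<^bsub>M\<^esub>B) \<in> generated \<I>"
    unfolding generated_def using coproduct_idealD(4)[of _ a B] by simp
qed

lemma residual_ideal:
  assumes K: "coproduct_ideal L M K" and J: "J \<subseteq> carrier L \<times> carrier M"
  shows "coproduct_ideal L M
    {p \<in> carrier L \<times> carrier M. \<forall>(a, b) \<in> J. (a \<sqinter>\<^bsub>L\<^esub> fst p, b \<sqinter>\<^bsub>M\<^esub> snd p) \<in> K}" (is "coproduct_ideal L M ?R")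
proof (rule coproduct_idealI)
  fix a b x y
  assume ab: "(a, b) \<in> ?R" and x: "x \<in> carrier L" and y: "y \<in> carrier M"
    and le: "x \<sqsubseteq>\<^bsub>L\<^esub> a" "y \<sqsubseteq>\<^bsub>M\<^esub> b"
  have "(c \<sqinter>\<^bsub>L\<^esub> x, d \<sqinter>\<^bsub>M\<^esub> y) \<in> K" if cd: "(c, d) \<in> J" for c d
  proof (rule coproduct_idealD(2)[OF K])
    show "(c \<sqinter>\<^bsub>L\<^esub> a, d \<sqinter>\<^bsub>M\<^esub> b) \<in> K" using ab cd by auto
    have c: "c \<in> carrier L" "d \<in> carrier M" "a \<in> carrier L" "b \<in> carrier M" using ab cd J by auto
    show "c \<sqinter>\<^bsub>L\<^esub> x \<in> carrier L" "d \<sqinter>\<^bsub>M\<^esub> y \<in> carrier M" using c x y by auto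
    show "c \<sqinter>\<^bsub>L\<^esub> x \<sqsubseteq>\<^bsub>L\<^esub> c \<sqinter>\<^bsub>L\<^esub> a"
      by (rule l.meet_le) (use l.meet_left l.meet_right l.le_trans[OF _ le(1)] c x in auto)
    show "d \<sqinter>\<^bsub>M\<^esub> y \<sqsubseteq>\<^bsub>M\<^esub> d \<sqinter>\<^bsub>M\<^esub> b"
      by (rule m.meet_le) (use m.meet_left m.meet_right m.le_trans[OF _ le(2)] c y in auto)
  qed
  then show "(x, y) \<in> ?R" using x y by auto
next
  fix A b assume A: "A \<subseteq> carrier L" "b \<in> carrier M" and R: "\<And>a. a \<in> A \<Longrightarrow> (a, b) \<in> ?R"
  have "(c \<sqinter>\<^bsub>L\<^esub> \<Squnion>\<^bsub>L\<^esub>A, d \<sqinter>\<^bsub>M\<^esub> b) \<in> K" if cd: "(c, d) \<in> J" for c d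
  proof -
    have c: "c \<in> carrier L" "d \<in> carrier M" using cd J by auto
    have "(\<Squnion>\<^bsub>L\<^esub>((\<lambda>x. c \<sqinter>\<^bsub>L\<^esub> x) ` A), d \<sqinter>\<^bsub>M\<^esub> b) \<in> K"
    proof (rule coproduct_idealD(3)[OF K])
      fix z assume "z \<in> (\<lambda>x. c \<sqinter>\<^bsub>L\<^esub> x) ` A"
      then obtain x where x: "x \<in> A" "z = c \<sqinter>\<^bsub>L\<^esub> x" by blast
      show "(z, d \<sqinter>\<^bsub>M\<^esub> b) \<in> K" using R[OF x(1)] cd unfolding x(2) by auto
    qed (use A c in auto)
    then show ?thesis using l.meet_sup_distrib[OF c(1) A(1)] by simp
  qed
  then show "(\<Squnion>\<^bsub>L\<^esub>A, b) \<in> ?R" using A by auto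
next
  fix a B assume B: "a \<in> carrier L" "B \<subseteq> carrier M" and R: "\<And>b. b \<in> B \<Longrightarrow> (a, b) \<in> ?R"
  have "(c \<sqinter>\<^bsub>L\<^esub> a, d \<sqinter>\<^bsub>M\<^esub> \<Squnion>\<^bsub>M\<^esub>B) \<in> K" if cd: "(c, d) \<in> J" for c d
  proof -
    have c: "c \<in> carrier L" "d \<in> carrier M" using cd J by auto
    have "(c \<sqinter>\<^bsub>L\<^esub> a, \<Squnion>\<^bsub>M\<^esub>((\<lambda>x. d \<sqinter>\<^bsub>M\<^esub> x) ` B)) \<in> K"
    proof (rule coproduct_idealD(4)[OF K])
      fix z assume "z \<in> (\<lambda>x. d \<sqinter>\<^bsub>M\<^esub> x) ` B"
      then obtain x where x: "x \<in> B" "z = d \<sqinter>\<^bsub>M\<^esub> x" by blast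
      show "(c \<sqinter>\<^bsub>L\<^esub> a, z) \<in> K" using R[OF x(1)] cd unfolding x(2) by auto
    qed (use B c in auto)
    then show ?thesis using m.meet_sup_distrib[OF c(2) B(2)] by simp
  qed
  then show "(a, \<Squnion>\<^bsub>M\<^esub>B) \<in> ?R" using B by auto
qed auto

lemma meet_idem_le: "x \<in> carrier L \<Longrightarrow> x \<sqsubseteq>\<^bsub>L\<^esub> x \<sqinter>\<^bsub>L\<^esub> x" "y \<in> carrier M \<Longrightarrow> y \<sqsubseteq>\<^bsub>M\<^esub> y \<sqinter>\<^bsub>M\<^esub> y"
  by (auto intro: l.meet_le m.meet_le)

lemma frame_frame_coproduct: "frame (frame_coproduct L M)"
  and sup_frame_coproduct:
    "\<I> \<subseteq> carrier (frame_coproduct L M) \<Longrightarrow> \<Squnion>\<^bsub>frame_coproduct L M\<^esub> \<I> = generated \<I>"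
  and meet_frame_coproduct:
    "\<lbrakk>I \<in> carrier (frame_coproduct L M); J \<in> carrier (frame_coproduct L M)\<rbrakk>
      \<Longrightarrow> I \<sqinter>\<^bsub>frame_coproduct L M\<^esub> J = I \<inter> J"
proof -
  let ?C = "frame_coproduct L M"
  have po: "partial_order ?C"
    by unfold_locales (auto simp: frame_coproduct_def)
  have distrib: "J \<inter> generated \<I> \<subseteq> generated ((\<inter>) J ` \<I>)"
    if J: "coproduct_ideal L M J" and I: "\<And>I. I \<in> \<I> \<Longrightarrow> coproduct_ideal L M I" for J \<I>
  proof -
    let ?K = "generated ((\<inter>) J ` \<I>)"
    have K: "coproduct_ideal L M ?K"
      by (rule coproduct_ideal_generated) (use J I coproduct_ideal_Int in auto)
    let ?R = "{p \<in> carrier L \<times> carrier M. \<forall>(a, b) \<in> J. (a \<sqinter>\<^bsub>L\<^esub> fst p, b \<sqinter>\<^bsub>M\<^esub> snd p) \<in> ?K}"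
    have "generated \<I> \<subseteq> ?R"
    proof (rule generated_least)
      show "coproduct_ideal L M ?R" by (rule residual_ideal[OF K coproduct_idealD(1)[OF J]])
      fix I' assume I': "I' \<in> \<I>"
      show "I' \<subseteq> ?R"
      proof
        fix p assume p: "p \<in> I'"
        then have pc: "fst p \<in> carrier L" "snd p \<in> carrier M"
          using coproduct_idealD(1)[OF I[OF I']] by auto
        have "(a \<sqinter>\<^bsub>L\<^esub> fst p, b \<sqinter>\<^bsub>M\<^esub> snd p) \<in> ?K" if ab: "(a, b) \<in> J" for a b
        proof -
          have c: "a \<in> carrier L" "b \<in> carrier M" using ab coproduct_idealD(1)[OF J] by auto
          have "(a \<sqinter>\<^bsub>L\<^esub> fst p, b \<sqinter>\<^bsub>M\<^esub> snd p) \<in> J"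
            by (rule coproduct_idealD(2)[OF J ab]) (use c pc l.meet_left m.meet_left in auto)
          moreover have "(a \<sqinter>\<^bsub>L\<^esub> fst p, b \<sqinter>\<^bsub>M\<^esub> snd p) \<in> I'"
            by (rule coproduct_idealD(2)[OF I[OF I'], of "fst p" "snd p"])
              (use p c pc l.meet_right m.meet_right in auto)
          moreover have "J \<inter> I' \<subseteq> ?K" by (rule generated_upper) (use I' in blast)
          ultimately show ?thesis by blast
        qed
        then show "p \<in> ?R" using pc by (auto simp: mem_Times_iff)
      qed
    qed
    show ?thesis
    proof
      fix p assume p: "p \<in> J \<inter> generated \<I>"
      obtain a b where ab: "p = (a, b)" by fastforce
      have c: "a \<in> carrier L" "b \<in> carrier M" using p coproduct_idealD(1)[OF J] ab by auto
      have "(a \<sqinter>\<^bsub>L\<^esub> a, b \<sqinter>\<^bsub>M\<^esub> b) \<in> ?K" using p subsetD[OF \<open>generated \<I> \<subseteq> ?R\<close>, of p] unfolding ab by auto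
      from coproduct_idealD(2)[OF K this c meet_idem_le(1)[OF c(1)] meet_idem_le(2)[OF c(2)]]
      show "p \<in> ?K" using ab by simp
    qed
  qed
  have C: "carrier ?C = {I. coproduct_ideal L M I}" "le ?C = (\<subseteq>)" "eq ?C = (=)"
    by (auto simp: frame_coproduct_def)
  note c = frame_criterion[OF po, of generated "(\<inter>)", unfolded C]
  have 1: "generated A \<in> {I. coproduct_ideal L M I}" if "A \<subseteq> {I. coproduct_ideal L M I}" for A
    using that coproduct_ideal_generated[of A] by blast
  have 2: "a \<subseteq> generated A" if "A \<subseteq> {I. coproduct_ideal L M I}" "a \<in> A" for a A
    using that(2) by (rule generated_upper)
  have 3: "generated A \<subseteq> u"
    if "A \<subseteq> {I. coproduct_ideal L M I}" "u \<in> {I. coproduct_ideal L M I}" "\<forall>a\<in>A. a \<subseteq> u" for A u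
    using that generated_least[of u A] by blast
  have 4: "a \<inter> b \<in> {I. coproduct_ideal L M I}"
    if "a \<in> {I. coproduct_ideal L M I}" "b \<in> {I. coproduct_ideal L M I}" for a b
    using that coproduct_ideal_Int by blast
  have 5: "a \<inter> generated A \<subseteq> generated ((\<inter>) a ` A)"
    if "a \<in> {I. coproduct_ideal L M I}" "A \<subseteq> {I. coproduct_ideal L M I}" for a A
    using that by (intro distrib) auto
  note d = c[OF 1 2 3 4 Int_lower1 Int_lower2 Int_greatest 5, folded C(1)]
  show "frame ?C" by (rule d; assumption)
  show "\<Squnion>\<^bsub>?C\<^esub> \<I> = generated \<I>" if "\<I> \<subseteq> carrier ?C"
    by (rule d; (assumption | rule that))
  show "I \<sqinter>\<^bsub>?C\<^esub> J = I \<inter> J" if "I \<in> carrier ?C" "J \<in> carrier ?C"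
    by (rule d; (assumption | rule that))
qed

lemma carrier_frame_coproduct: "carrier (frame_coproduct L M) = {I. coproduct_ideal L M I}"
  by (simp add: frame_coproduct_def)

lemma le_bottomD: "x \<sqsubseteq>\<^bsub>L\<^esub> \<bottom>\<^bsub>L\<^esub> \<Longrightarrow> x \<in> carrier L \<Longrightarrow> x = \<bottom>\<^bsub>L\<^esub>"
  "y \<sqsubseteq>\<^bsub>M\<^esub> \<bottom>\<^bsub>M\<^esub> \<Longrightarrow> y \<in> carrier M \<Longrightarrow> y = \<bottom>\<^bsub>M\<^esub>"
  by (simp_all add: l.le_antisym m.le_antisym)

lemma coproduct_ideal_inl:
  assumes a: "a \<in> carrier L"
  shows "coproduct_ideal L M (coproduct_inl L M a)"
proof (rule coproduct_idealI)
  fix c d x y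
  assume h: "(c, d) \<in> coproduct_inl L M a" "x \<in> carrier L" "y \<in> carrier M" "x \<sqsubseteq>\<^bsub>L\<^esub> c" "y \<sqsubseteq>\<^bsub>M\<^esub> d"
  then consider "c \<sqsubseteq>\<^bsub>L\<^esub> a" | "d = \<bottom>\<^bsub>M\<^esub>" by (auto simp: coproduct_inl_def)
  then show "(x, y) \<in> coproduct_inl L M a"
  proof cases
    case 1
    then have "x \<sqsubseteq>\<^bsub>L\<^esub> a" using l.le_trans[OF h(4) 1] h a by (auto simp: coproduct_inl_def)
    then show ?thesis using h by (simp add: coproduct_inl_def)
  next
    case 2
    then have "y = \<bottom>\<^bsub>M\<^esub>" using h le_bottomD(2) by blast
    then show ?thesis using h by (simp add: coproduct_inl_def)
  qed
next
  fix A b assume h: "A \<subseteq> carrier L" "b \<in> carrier M" "\<And>x. x \<in> A \<Longrightarrow> (x, b) \<in> coproduct_inl L M a"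
  show "(\<Squnion>\<^bsub>L\<^esub>A, b) \<in> coproduct_inl L M a"
  proof (cases "b = \<bottom>\<^bsub>M\<^esub>")
    case False
    then have "\<Squnion>\<^bsub>L\<^esub>A \<sqsubseteq>\<^bsub>L\<^esub> a"
      using h by (intro l.weak.sup_least a) (auto simp: coproduct_inl_def)
    then show ?thesis using h by (simp add: coproduct_inl_def)
  qed (use h in \<open>simp add: coproduct_inl_def\<close>)
next
  fix c B assume h: "c \<in> carrier L" "B \<subseteq> carrier M" "\<And>b. b \<in> B \<Longrightarrow> (c, b) \<in> coproduct_inl L M a"
  show "(c, \<Squnion>\<^bsub>M\<^esub>B) \<in> coproduct_inl L M a"
  proof (cases "c \<sqsubseteq>\<^bsub>L\<^esub> a")
    case False
    then have "\<Squnion>\<^bsub>M\<^esub>B \<sqsubseteq>\<^bsub>M\<^esub> \<bottom>\<^bsub>M\<^esub>"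
      using h by (intro m.weak.sup_least) (auto simp: coproduct_inl_def)
    then have "\<Squnion>\<^bsub>M\<^esub>B = \<bottom>\<^bsub>M\<^esub>" using h le_bottomD(2) by simp
    then show ?thesis using h by (simp add: coproduct_inl_def)
  qed (use h in \<open>simp add: coproduct_inl_def\<close>)
qed (auto simp: coproduct_inl_def)

lemma coproduct_inl_carrier:
  "a \<in> carrier L \<Longrightarrow> coproduct_inl L M a \<in> carrier (frame_coproduct L M)"
  by (simp add: carrier_frame_coproduct coproduct_ideal_inl)

lemma inl_mem: "a \<in> carrier L \<Longrightarrow> y \<in> carrier M \<Longrightarrow> (a, y) \<in> coproduct_inl L M a"
  by (simp add: coproduct_inl_def)

lemma inl_least:
  assumes "coproduct_ideal L M I" "(a, \<top>\<^bsub>M\<^esub>) \<in> I"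
  shows "coproduct_inl L M a \<subseteq> I"
proof
  fix p assume p: "p \<in> coproduct_inl L M a"
  obtain x y where xy: "p = (x, y)" by fastforce
  have c: "x \<in> carrier L" "y \<in> carrier M" "x \<sqsubseteq>\<^bsub>L\<^esub> a \<or> y = \<bottom>\<^bsub>M\<^esub>"
    using p xy by (auto simp: coproduct_inl_def)
  show "p \<in> I"
  proof (cases "y = \<bottom>\<^bsub>M\<^esub>")
    case True
    then show ?thesis using coproduct_ideal_bottom(1)[OF assms(1) c(1)] xy by simp
  next
    case False
    then show ?thesis
      using coproduct_idealD(2)[OF assms c(1,2)] c m.top_higher[OF c(2)] xy by simp
  qed
qed

lemma frame_map_inl: "frame_map L (frame_coproduct L M) (coproduct_inl L M)"
proof (rule frame_mapI[OF l.frame_axioms frame_frame_coproduct coproduct_inl_carrier])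
  fix A assume A: "A \<subseteq> carrier L"
  have im: "coproduct_inl L M ` A \<subseteq> carrier (frame_coproduct L M)"
    using A coproduct_inl_carrier by auto
  have g: "coproduct_ideal L M (generated (coproduct_inl L M ` A))"
    by (rule coproduct_ideal_generated) (use im carrier_frame_coproduct in auto)
  have "coproduct_inl L M (\<Squnion>\<^bsub>L\<^esub>A) = generated (coproduct_inl L M ` A)"
  proof
    have "(a, \<top>\<^bsub>M\<^esub>) \<in> generated (coproduct_inl L M ` A)" if "a \<in> A" for a
      using generated_upper[of "coproduct_inl L M a" "coproduct_inl L M ` A"] that A inl_mem[of a "\<top>\<^bsub>M\<^esub>"]
      by auto
    then have "(\<Squnion>\<^bsub>L\<^esub>A, \<top>\<^bsub>M\<^esub>) \<in> generated (coproduct_inl L M ` A)"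
      by (intro coproduct_idealD(3)[OF g] A) auto
    then show "coproduct_inl L M (\<Squnion>\<^bsub>L\<^esub>A) \<subseteq> generated (coproduct_inl L M ` A)"
      by (rule inl_least[OF g])
    show "generated (coproduct_inl L M ` A) \<subseteq> coproduct_inl L M (\<Squnion>\<^bsub>L\<^esub>A)"
    proof (rule generated_least)
      show "coproduct_ideal L M (coproduct_inl L M (\<Squnion>\<^bsub>L\<^esub>A))"
        by (rule coproduct_ideal_inl) (use A in simp)
      fix I assume "I \<in> coproduct_inl L M ` A"
      then obtain a where a: "a \<in> A" "I = coproduct_inl L M a" by blast
      have "(a, \<top>\<^bsub>M\<^esub>) \<in> coproduct_inl L M (\<Squnion>\<^bsub>L\<^esub>A)"
        using a A l.weak.sup_upper[OF A a(1)] by (auto simp: coproduct_inl_def)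
      then show "I \<subseteq> coproduct_inl L M (\<Squnion>\<^bsub>L\<^esub>A)"
        unfolding a(2) by (rule inl_least[OF \<open>coproduct_ideal L M (coproduct_inl L M (\<Squnion>\<^bsub>L\<^esub>A))\<close>])
    qed
  qed
  then show "coproduct_inl L M (\<Squnion>\<^bsub>L\<^esub>A) = \<Squnion>\<^bsub>frame_coproduct L M\<^esub>(coproduct_inl L M ` A)"
    using sup_frame_coproduct[OF im] by simp
next
  fix x y assume xy: "x \<in> carrier L" "y \<in> carrier L"
  have "a \<sqsubseteq>\<^bsub>L\<^esub> x \<sqinter>\<^bsub>L\<^esub> y \<longleftrightarrow> a \<sqsubseteq>\<^bsub>L\<^esub> x \<and> a \<sqsubseteq>\<^bsub>L\<^esub> y" if "a \<in> carrier L" for a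
    using l.meet_le[of a x y] l.le_trans[of a "x \<sqinter>\<^bsub>L\<^esub> y" x] l.le_trans[of a "x \<sqinter>\<^bsub>L\<^esub> y" y]
      l.meet_left[OF xy] l.meet_right[OF xy] xy that by auto
  then show "coproduct_inl L M (x \<sqinter>\<^bsub>L\<^esub> y) = coproduct_inl L M x \<sqinter>\<^bsub>frame_coproduct L M\<^esub> coproduct_inl L M y"
    unfolding meet_frame_coproduct[OF coproduct_inl_carrier[OF xy(1)] coproduct_inl_carrier[OF xy(2)]]
    by (auto simp: coproduct_inl_def)
next
  have "coproduct_inl L M \<top>\<^bsub>L\<^esub> = carrier L \<times> carrier M"
    by (auto simp: coproduct_inl_def)
  moreover have "\<top>\<^bsub>frame_coproduct L M\<^esub> = carrier L \<times> carrier M"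
    using frame_frame_coproduct coproduct_ideal_Times
    by (intro is_greatest_imp_top) (auto simp: frame_def frame_coproduct_def dest: coproduct_idealD(1))
  ultimately show "coproduct_inl L M \<top>\<^bsub>L\<^esub> = \<top>\<^bsub>frame_coproduct L M\<^esub>" by simp
qed

end

lemma (in two_frames) coproduct_ideal_converse:
  assumes "coproduct_ideal M L I"
  shows "coproduct_ideal L M (I\<inverse>)"
proof -
  interpret swap: two_frames M L by unfold_locales
  show ?thesis
  proof (rule coproduct_idealI)
    fix a b x y
    assume "(a, b) \<in> I\<inverse>" "x \<in> carrier L" "y \<in> carrier M" "x \<sqsubseteq>\<^bsub>L\<^esub> a" "y \<sqsubseteq>\<^bsub>M\<^esub> b"
    then show "(x, y) \<in> I\<inverse>" using swap.coproduct_idealD(2)[OF assms, of b a y x] by simp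
  qed (use swap.coproduct_idealD(1,3,4)[OF assms] in auto)
qed

lemma (in two_frames) frame_map_inr: "frame_map M (frame_coproduct L M) (coproduct_inr L M)"
proof -
  interpret swap: two_frames M L by unfold_locales
  have inr: "coproduct_inr L M = (\<lambda>b. (coproduct_inl M L b)\<inverse>)"
    by (auto simp: coproduct_inl_def coproduct_inr_def fun_eq_iff)
  have conv: "I\<inverse> \<in> carrier (frame_coproduct L M)" if "I \<in> carrier (frame_coproduct M L)" for I
    using that coproduct_ideal_converse by (simp add: carrier_frame_coproduct swap.carrier_frame_coproduct)
  have conv': "I\<inverse> \<in> carrier (frame_coproduct M L)" if "I \<in> carrier (frame_coproduct L M)" for I
    using that swap.coproduct_ideal_converse by (simp add: carrier_frame_coproduct swap.carrier_frame_coproduct)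
  have cl: "complete_lattice (frame_coproduct L M)" "complete_lattice (frame_coproduct M L)"
    using frame_frame_coproduct swap.frame_frame_coproduct by (simp_all add: frame_def)
  interpret ml: complete_lattice "frame_coproduct M L" by fact
  have le: "le (frame_coproduct M L) = (\<subseteq>)" "le (frame_coproduct L M) = (\<subseteq>)"
    by (simp_all add: frame_coproduct_def)
  have "frame_map (frame_coproduct M L) (frame_coproduct L M) converse"
  proof (rule frame_mapI[OF swap.frame_frame_coproduct frame_frame_coproduct conv])
    fix \<I> assume I: "\<I> \<subseteq> carrier (frame_coproduct M L)"
    show "(\<Squnion>\<^bsub>frame_coproduct M L\<^esub>\<I>)\<inverse> = \<Squnion>\<^bsub>frame_coproduct L M\<^esub>(converse ` \<I>)"
    proof (rule is_lub_imp_sup[symmetric, OF cl(1)])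
      show "a \<sqsubseteq>\<^bsub>frame_coproduct L M\<^esub> (\<Squnion>\<^bsub>frame_coproduct M L\<^esub>\<I>)\<inverse>"
        if "a \<in> converse ` \<I>" for a
        using that ml.weak.sup_upper[OF I] unfolding le by auto
      show "(\<Squnion>\<^bsub>frame_coproduct M L\<^esub>\<I>)\<inverse> \<sqsubseteq>\<^bsub>frame_coproduct L M\<^esub> u"
        if u: "u \<in> carrier (frame_coproduct L M)"
          "\<forall>a\<in>converse ` \<I>. a \<sqsubseteq>\<^bsub>frame_coproduct L M\<^esub> u" for u
      proof -
        have "\<Squnion>\<^bsub>frame_coproduct M L\<^esub>\<I> \<subseteq> u\<inverse>"
          by (rule ml.weak.sup_least[OF I conv'[OF u(1)], unfolded le]) (use u(2) le in auto)
        then show ?thesis unfolding le by blast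
      qed
    qed (use I conv ml.weak.sup_closed[OF I] in auto)
  next
    fix I J assume IJ: "I \<in> carrier (frame_coproduct M L)" "J \<in> carrier (frame_coproduct M L)"
    show "(I \<sqinter>\<^bsub>frame_coproduct M L\<^esub> J)\<inverse> = I\<inverse> \<sqinter>\<^bsub>frame_coproduct L M\<^esub> J\<inverse>"
      unfolding swap.meet_frame_coproduct[OF IJ] meet_frame_coproduct[OF conv[OF IJ(1)] conv[OF IJ(2)]]
      by blast
  next
    have "u \<subseteq> (\<top>\<^bsub>frame_coproduct M L\<^esub>)\<inverse>" if "u \<in> carrier (frame_coproduct L M)" for u
      using ml.top_higher[OF conv'[OF that]] unfolding le by auto
    then show "(\<top>\<^bsub>frame_coproduct M L\<^esub>)\<inverse> = \<top>\<^bsub>frame_coproduct L M\<^esub>"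
      by (intro is_greatest_imp_top[symmetric, OF cl(1)]) (simp_all add: conv le)
  qed
  from frame_map_comp[OF swap.frame_map_inl this m.frame_axioms frame_frame_coproduct]
  show ?thesis unfolding inr comp_def .
qed

lemma (in two_frames) inl_meet_inr:
  assumes "a \<in> carrier L" "b \<in> carrier M"
  shows "(a, b) \<in> coproduct_inl L M a \<sqinter>\<^bsub>frame_coproduct L M\<^esub> coproduct_inr L M b"
    and "\<lbrakk>coproduct_ideal L M I; (a, b) \<in> I\<rbrakk>
      \<Longrightarrow> coproduct_inl L M a \<sqinter>\<^bsub>frame_coproduct L M\<^esub> coproduct_inr L M b \<subseteq> I"
proof -
  note m = meet_frame_coproduct[OF frame_mapD(1)[OF frame_map_inl assms(1)] frame_mapD(1)[OF frame_map_inr assms(2)]]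
  show "(a, b) \<in> coproduct_inl L M a \<sqinter>\<^bsub>frame_coproduct L M\<^esub> coproduct_inr L M b"
    unfolding m using assms by (auto simp: coproduct_inl_def coproduct_inr_def)
  show "coproduct_inl L M a \<sqinter>\<^bsub>frame_coproduct L M\<^esub> coproduct_inr L M b \<subseteq> I"
    if I: "coproduct_ideal L M I" and ab: "(a, b) \<in> I"
    unfolding m
  proof
    fix p assume p: "p \<in> coproduct_inl L M a \<inter> coproduct_inr L M b"
    obtain x y where xy: "p = (x, y)" by fastforce
    have c: "x \<in> carrier L" "y \<in> carrier M" "x \<sqsubseteq>\<^bsub>L\<^esub> a \<or> y = \<bottom>\<^bsub>M\<^esub>" "x = \<bottom>\<^bsub>L\<^esub> \<or> y \<sqsubseteq>\<^bsub>M\<^esub> b"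
      using p xy by (auto simp: coproduct_inl_def coproduct_inr_def)
    show "p \<in> I"
      using coproduct_ideal_bottom[OF I] coproduct_idealD(2)[OF I ab c(1,2)] c xy by auto
  qed
qed

lemma (in two_frames) frame_coproduct_generated:
  assumes "I \<in> carrier (frame_coproduct L M)"
  shows "I = \<Squnion>\<^bsub>frame_coproduct L M\<^esub>
    ((\<lambda>(a, b). coproduct_inl L M a \<sqinter>\<^bsub>frame_coproduct L M\<^esub> coproduct_inr L M b) ` I)"
proof -
  have I: "coproduct_ideal L M I" using assms by (simp add: carrier_frame_coproduct)
  note sub = coproduct_idealD(1)[OF I]
  have cl: "complete_lattice (frame_coproduct L M)"
    using frame_frame_coproduct by (simp add: frame_def)
  interpret c: complete_lattice "frame_coproduct L M" by fact
  have le: "le (frame_coproduct L M) = (\<subseteq>)" by (simp add: frame_coproduct_def)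
  show ?thesis
  proof (rule is_lub_imp_sup[symmetric, OF cl])
    show "(\<lambda>(a, b). coproduct_inl L M a \<sqinter>\<^bsub>frame_coproduct L M\<^esub> coproduct_inr L M b) ` I
        \<subseteq> carrier (frame_coproduct L M)"
      using sub frame_mapD(1)[OF frame_map_inl] frame_mapD(1)[OF frame_map_inr] by auto
    show "z \<sqsubseteq>\<^bsub>frame_coproduct L M\<^esub> I"
      if z: "z \<in> (\<lambda>(a, b). coproduct_inl L M a \<sqinter>\<^bsub>frame_coproduct L M\<^esub> coproduct_inr L M b) ` I" for z
    proof -
      obtain p where p: "p \<in> I"
        "z = coproduct_inl L M (fst p) \<sqinter>\<^bsub>frame_coproduct L M\<^esub> coproduct_inr L M (snd p)"
        using z by (force simp: split_beta)
      show ?thesis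
        unfolding le p(2) by (rule inl_meet_inr(2)) (use I p(1) sub in auto)
    qed
    show "I \<sqsubseteq>\<^bsub>frame_coproduct L M\<^esub> u"
      if "\<forall>z\<in>(\<lambda>(a, b). coproduct_inl L M a \<sqinter>\<^bsub>frame_coproduct L M\<^esub> coproduct_inr L M b) ` I.
            z \<sqsubseteq>\<^bsub>frame_coproduct L M\<^esub> u" for u
      unfolding le
    proof
      fix p assume "p \<in> I"
      then show "p \<in> u"
        using bspec[OF that imageI[OF \<open>p \<in> I\<close>]] inl_meet_inr(1)[of "fst p" "snd p"] subsetD[OF sub, of p]
        unfolding le by (cases p) auto
    qed
  qed fact
qed

lemma (in frame) sup_meet_sup_le:
  assumes A: "A \<subseteq> carrier L" and B: "B \<subseteq> carrier L" and z: "z \<in> carrier L"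
    and le: "\<And>a b. a \<in> A \<Longrightarrow> b \<in> B \<Longrightarrow> a \<sqinter> b \<sqsubseteq> z"
  shows "\<Squnion>A \<sqinter> \<Squnion>B \<sqsubseteq> z"
proof -
  have b: "\<Squnion>A \<sqinter> b \<sqsubseteq> z" if "b \<in> B" for b
  proof -
    have bc: "b \<in> carrier L" using that B by auto
    have "\<Squnion>A \<sqinter> b = \<Squnion>((\<lambda>x. b \<sqinter> x) ` A)"
      using meet_sup_distrib[OF bc A] meet_comm[of L "\<Squnion>A" b] by simp
    also have "\<dots> \<sqsubseteq> z"
    proof (rule weak.sup_least)
      fix y assume "y \<in> (\<lambda>x. b \<sqinter> x) ` A"
      then obtain x where "x \<in> A" "y = b \<sqinter> x" by blast
      then show "y \<sqsubseteq> z" using le[OF _ that, of x] meet_comm[of L b x] by simp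
    qed (use A bc z in auto)
    finally show ?thesis .
  qed
  have "\<Squnion>A \<sqinter> \<Squnion>B = \<Squnion>((\<lambda>x. \<Squnion>A \<sqinter> x) ` B)"
    using A B by (intro meet_sup_distrib) auto
  also have "\<dots> \<sqsubseteq> z"
    by (rule weak.sup_least) (use A B b z in auto)
  finally show ?thesis .
qed

lemma frame_coproduct_universal:
  assumes "frame L" "frame M" "frame K" and f: "frame_map L K f" and g: "frame_map M K g"
  shows "\<exists>h. frame_map (frame_coproduct L M) K h \<and>
      (\<forall>a\<in>carrier L. h (coproduct_inl L M a) = f a) \<and> (\<forall>b\<in>carrier M. h (coproduct_inr L M b) = g b)"
    and "\<lbrakk>frame_map (frame_coproduct L M) K h; frame_map (frame_coproduct L M) K h';
      \<forall>a\<in>carrier L. h (coproduct_inl L M a) = h' (coproduct_inl L M a);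
      \<forall>b\<in>carrier M. h (coproduct_inr L M b) = h' (coproduct_inr L M b);
      I \<in> carrier (frame_coproduct L M)\<rbrakk> \<Longrightarrow> h I = h' I"
proof -
  interpret two_frames L M using assms(1,2) by (simp add: two_frames_def)
  interpret k: frame K by fact
  let ?C = "frame_coproduct L M"
  note fc = frame_mapD(1)[OF f] and gc = frame_mapD(1)[OF g]
  define t where "t = (\<lambda>(a, b). f a \<sqinter>\<^bsub>K\<^esub> g b)"
  have tc: "t (a, b) \<in> carrier K" if "a \<in> carrier L" "b \<in> carrier M" for a b
    using that fc gc by (simp add: t_def)
  have t_sub: "t ` I \<subseteq> carrier K" if "coproduct_ideal L M I" for I
    using coproduct_idealD(1)[OF that] tc by auto
  define h where "h I = \<Squnion>\<^bsub>K\<^esub>(t ` I)" for I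
  have hc: "h I \<in> carrier K" if "coproduct_ideal L M I" for I
    using t_sub[OF that] by (simp add: h_def)
  have t_mono: "t (x, y) \<sqsubseteq>\<^bsub>K\<^esub> t (a, b)"
    if "x \<in> carrier L" "y \<in> carrier M" "a \<in> carrier L" "b \<in> carrier M" "x \<sqsubseteq>\<^bsub>L\<^esub> a" "y \<sqsubseteq>\<^bsub>M\<^esub> b" for x y a b
  proof -
    have le: "f x \<sqsubseteq>\<^bsub>K\<^esub> f a" "g y \<sqsubseteq>\<^bsub>K\<^esub> g b"
      using that frame_map_mono[OF f assms(1,3)] frame_map_mono[OF g assms(2,3)] by auto
    note c = fc[OF that(1)] gc[OF that(2)] fc[OF that(3)] gc[OF that(4)]
    show ?thesis unfolding t_def prod.case
      by (rule k.meet_le)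
        (use k.le_trans[OF k.meet_left le(1)] k.le_trans[OF k.meet_right le(2)] c in auto)
  qed
  have ideal: "coproduct_ideal L M {p \<in> carrier L \<times> carrier M. t p \<sqsubseteq>\<^bsub>K\<^esub> z}" (is "coproduct_ideal L M ?R")
    if z: "z \<in> carrier K" for z
  proof (rule coproduct_idealI)
    fix a b x y
    assume h: "(a, b) \<in> ?R" "x \<in> carrier L" "y \<in> carrier M" "x \<sqsubseteq>\<^bsub>L\<^esub> a" "y \<sqsubseteq>\<^bsub>M\<^esub> b"
    then have "t (x, y) \<sqsubseteq>\<^bsub>K\<^esub> z"
      using k.le_trans[OF t_mono[of x y a b], of z] tc z by auto
    then show "(x, y) \<in> ?R" using h by simp
  next
    fix A b assume A: "A \<subseteq> carrier L" "b \<in> carrier M" and R: "\<And>a. a \<in> A \<Longrightarrow> (a, b) \<in> ?R"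
    have "\<Squnion>\<^bsub>K\<^esub>(f ` A) \<sqinter>\<^bsub>K\<^esub> \<Squnion>\<^bsub>K\<^esub>{g b} \<sqsubseteq>\<^bsub>K\<^esub> z"
    proof (rule k.sup_meet_sup_le[OF _ _ z])
      fix u v assume "u \<in> f ` A" "v \<in> {g b}"
      then obtain a where "a \<in> A" "u = f a" "v = g b" by blast
      then show "u \<sqinter>\<^bsub>K\<^esub> v \<sqsubseteq>\<^bsub>K\<^esub> z" using R[of a] by (simp add: t_def)
    qed (use A fc gc in auto)
    then have "t (\<Squnion>\<^bsub>L\<^esub>A, b) \<sqsubseteq>\<^bsub>K\<^esub> z"
      using A frame_mapD(2)[OF f A(1)] gc by (simp add: t_def)
    then show "(\<Squnion>\<^bsub>L\<^esub>A, b) \<in> ?R" using A by simp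
  next
    fix a B assume B: "a \<in> carrier L" "B \<subseteq> carrier M" and R: "\<And>b. b \<in> B \<Longrightarrow> (a, b) \<in> ?R"
    have "\<Squnion>\<^bsub>K\<^esub>{f a} \<sqinter>\<^bsub>K\<^esub> \<Squnion>\<^bsub>K\<^esub>(g ` B) \<sqsubseteq>\<^bsub>K\<^esub> z"
    proof (rule k.sup_meet_sup_le[OF _ _ z])
      fix u v assume "u \<in> {f a}" "v \<in> g ` B"
      then obtain b where "b \<in> B" "u = f a" "v = g b" by blast
      then show "u \<sqinter>\<^bsub>K\<^esub> v \<sqsubseteq>\<^bsub>K\<^esub> z" using R[of b] by (simp add: t_def)
    qed (use B fc gc in auto)
    then have "t (a, \<Squnion>\<^bsub>M\<^esub>B) \<sqsubseteq>\<^bsub>K\<^esub> z"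
      using B frame_mapD(2)[OF g B(2)] fc by (simp add: t_def)
    then show "(a, \<Squnion>\<^bsub>M\<^esub>B) \<in> ?R" using B by simp
  qed auto
  have h_le: "h I \<sqsubseteq>\<^bsub>K\<^esub> z" if "coproduct_ideal L M I" "z \<in> carrier K" "\<And>p. p \<in> I \<Longrightarrow> t p \<sqsubseteq>\<^bsub>K\<^esub> z" for I z
    unfolding h_def by (rule k.weak.sup_least) (use that t_sub in auto)
  have h_upper: "t p \<sqsubseteq>\<^bsub>K\<^esub> h I" if "coproduct_ideal L M I" "p \<in> I" for p I
    unfolding h_def by (rule k.weak.sup_upper) (use that t_sub in auto)
  have h_mono: "h I \<sqsubseteq>\<^bsub>K\<^esub> h J" if "coproduct_ideal L M I" "coproduct_ideal L M J" "I \<subseteq> J" for I J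
    using that by (intro h_le hc h_upper) auto
  have le: "le ?C = (\<subseteq>)" by (simp add: frame_coproduct_def)
  have map: "frame_map ?C K h"
  proof (rule frame_mapI[OF frame_frame_coproduct assms(3)])
    show "h I \<in> carrier K" if "I \<in> carrier ?C" for I
      using that hc by (simp add: carrier_frame_coproduct)
  next
    fix \<I> assume I: "\<I> \<subseteq> carrier ?C"
    then have I': "\<And>I. I \<in> \<I> \<Longrightarrow> coproduct_ideal L M I" by (auto simp: carrier_frame_coproduct)
    note gen = coproduct_ideal_generated[OF I']
    have "h (generated \<I>) = \<Squnion>\<^bsub>K\<^esub>(h ` \<I>)"
    proof (rule is_lub_imp_sup[symmetric, OF k.complete_lattice_axioms])
      show "h ` \<I> \<subseteq> carrier K" using I' hc by auto
      show "h (generated \<I>) \<in> carrier K" by (rule hc[OF gen])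
      show "z \<sqsubseteq>\<^bsub>K\<^esub> h (generated \<I>)" if "z \<in> h ` \<I>" for z
        using that h_mono[OF I' gen generated_upper] by auto
      show "h (generated \<I>) \<sqsubseteq>\<^bsub>K\<^esub> u" if u: "u \<in> carrier K" "\<forall>z\<in>h ` \<I>. z \<sqsubseteq>\<^bsub>K\<^esub> u" for u
      proof (rule h_le[OF gen u(1)])
        have "generated \<I> \<subseteq> {p \<in> carrier L \<times> carrier M. t p \<sqsubseteq>\<^bsub>K\<^esub> u}"
        proof (rule generated_least[OF ideal[OF u(1)]])
          fix J assume J: "J \<in> \<I>"
          show "J \<subseteq> {p \<in> carrier L \<times> carrier M. t p \<sqsubseteq>\<^bsub>K\<^esub> u}"
          proof
            fix p assume p: "p \<in> J"
            then have pc: "p \<in> carrier L \<times> carrier M" using coproduct_idealD(1)[OF I'[OF J]] by auto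
            have "t p \<sqsubseteq>\<^bsub>K\<^esub> u"
              using k.le_trans[OF h_upper[OF I'[OF J] p], of u] u J pc tc hc[OF I'[OF J]] by auto
            then show "p \<in> {p \<in> carrier L \<times> carrier M. t p \<sqsubseteq>\<^bsub>K\<^esub> u}" using pc by simp
          qed
        qed
        then show "t p \<sqsubseteq>\<^bsub>K\<^esub> u" if "p \<in> generated \<I>" for p using that by auto
      qed
    qed
    then show "h (\<Squnion>\<^bsub>?C\<^esub>\<I>) = \<Squnion>\<^bsub>K\<^esub>(h ` \<I>)" using sup_frame_coproduct[OF I] by simp
  next
    fix I J assume "I \<in> carrier ?C" "J \<in> carrier ?C"
    note m = meet_frame_coproduct[OF this]
    from \<open>I \<in> carrier ?C\<close> \<open>J \<in> carrier ?C\<close> have I: "coproduct_ideal L M I" and J: "coproduct_ideal L M J"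
      by (auto simp: carrier_frame_coproduct)
    note IJ = coproduct_ideal_Int[OF I J]
    have "h (I \<inter> J) = h I \<sqinter>\<^bsub>K\<^esub> h J"
    proof (rule k.le_antisym)
      show "h (I \<inter> J) \<sqsubseteq>\<^bsub>K\<^esub> h I \<sqinter>\<^bsub>K\<^esub> h J"
        by (rule k.meet_le) (use I J IJ hc h_mono in auto)
      show "h I \<sqinter>\<^bsub>K\<^esub> h J \<sqsubseteq>\<^bsub>K\<^esub> h (I \<inter> J)"
        unfolding h_def[of I] h_def[of J]
      proof (rule k.sup_meet_sup_le[OF t_sub[OF I] t_sub[OF J] hc[OF IJ]])
        fix u v assume "u \<in> t ` I" "v \<in> t ` J"
        then obtain a b a' b' where ab: "(a, b) \<in> I" "u = f a \<sqinter>\<^bsub>K\<^esub> g b"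
          and ab': "(a', b') \<in> J" "v = f a' \<sqinter>\<^bsub>K\<^esub> g b'"
          by (auto simp: t_def)
        have c: "a \<in> carrier L" "b \<in> carrier M" "a' \<in> carrier L" "b' \<in> carrier M"
          using ab ab' coproduct_idealD(1)[OF I] coproduct_idealD(1)[OF J] by auto
        note kc = fc[OF c(1)] gc[OF c(2)] fc[OF c(3)] gc[OF c(4)]
        have "(a \<sqinter>\<^bsub>L\<^esub> a', b \<sqinter>\<^bsub>M\<^esub> b') \<in> I"
          by (rule coproduct_idealD(2)[OF I ab(1)]) (use c l.meet_left m.meet_left in auto)
        moreover have "(a \<sqinter>\<^bsub>L\<^esub> a', b \<sqinter>\<^bsub>M\<^esub> b') \<in> J"
          by (rule coproduct_idealD(2)[OF J ab'(1)]) (use c l.meet_right m.meet_right in auto)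
        ultimately have "t (a \<sqinter>\<^bsub>L\<^esub> a', b \<sqinter>\<^bsub>M\<^esub> b') \<sqsubseteq>\<^bsub>K\<^esub> h (I \<inter> J)"
          by (intro h_upper[OF IJ]) auto
        moreover have "t (a \<sqinter>\<^bsub>L\<^esub> a', b \<sqinter>\<^bsub>M\<^esub> b') = (f a \<sqinter>\<^bsub>K\<^esub> f a') \<sqinter>\<^bsub>K\<^esub> (g b \<sqinter>\<^bsub>K\<^esub> g b')"
          using c frame_mapD(3)[OF f] frame_mapD(3)[OF g] by (simp add: t_def)
        moreover have "(f a \<sqinter>\<^bsub>K\<^esub> f a') \<sqinter>\<^bsub>K\<^esub> (g b \<sqinter>\<^bsub>K\<^esub> g b') = u \<sqinter>\<^bsub>K\<^esub> v"
        proof -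
          have "(f a \<sqinter>\<^bsub>K\<^esub> f a') \<sqinter>\<^bsub>K\<^esub> (g b \<sqinter>\<^bsub>K\<^esub> g b') = f a \<sqinter>\<^bsub>K\<^esub> ((f a' \<sqinter>\<^bsub>K\<^esub> g b) \<sqinter>\<^bsub>K\<^esub> g b')"
            using kc by (simp add: k.meet_assoc)
          also have "\<dots> = f a \<sqinter>\<^bsub>K\<^esub> ((g b \<sqinter>\<^bsub>K\<^esub> f a') \<sqinter>\<^bsub>K\<^esub> g b')"
            using meet_comm[of K "f a'" "g b"] by simp
          also have "\<dots> = u \<sqinter>\<^bsub>K\<^esub> v"
            using kc by (simp add: k.meet_assoc ab ab')
          finally show ?thesis .
        qed
        ultimately show "u \<sqinter>\<^bsub>K\<^esub> v \<sqsubseteq>\<^bsub>K\<^esub> h (I \<inter> J)" by simp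
      qed
    qed (use I J IJ hc in auto)
    then show "h (I \<sqinter>\<^bsub>?C\<^esub> J) = h I \<sqinter>\<^bsub>K\<^esub> h J" by (simp add: m)
  next
    interpret c: frame ?C by (rule frame_frame_coproduct)
    have topI: "coproduct_ideal L M \<top>\<^bsub>?C\<^esub>" using c.top_closed by (simp add: carrier_frame_coproduct)
    have "(\<top>\<^bsub>L\<^esub>, \<top>\<^bsub>M\<^esub>) \<in> \<top>\<^bsub>?C\<^esub>"
      using c.top_higher[of "carrier L \<times> carrier M"] coproduct_ideal_Times
      by (auto simp: carrier_frame_coproduct le)
    from h_upper[OF topI this] have "\<top>\<^bsub>K\<^esub> \<sqinter>\<^bsub>K\<^esub> \<top>\<^bsub>K\<^esub> \<sqsubseteq>\<^bsub>K\<^esub> h \<top>\<^bsub>?C\<^esub>"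
      using frame_mapD(4)[OF f] frame_mapD(4)[OF g] by (simp add: t_def)
    moreover have "\<top>\<^bsub>K\<^esub> \<sqinter>\<^bsub>K\<^esub> \<top>\<^bsub>K\<^esub> = \<top>\<^bsub>K\<^esub>"
      using k.le_iff_meet[of "\<top>\<^bsub>K\<^esub>" "\<top>\<^bsub>K\<^esub>"] by simp
    ultimately show "h \<top>\<^bsub>?C\<^esub> = \<top>\<^bsub>K\<^esub>"
      using hc[OF topI] by (intro k.le_antisym) auto
  qed
  have "h (coproduct_inl L M a) = f a" if a: "a \<in> carrier L" for a
  proof (rule k.le_antisym)
    note i = coproduct_ideal_inl[OF a]
    have "coproduct_inl L M a \<subseteq> {p \<in> carrier L \<times> carrier M. t p \<sqsubseteq>\<^bsub>K\<^esub> f a}"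
      by (rule inl_least[OF ideal]) (use a fc gc k.meet_left in \<open>auto simp: t_def\<close>)
    then show "h (coproduct_inl L M a) \<sqsubseteq>\<^bsub>K\<^esub> f a" using i a fc by (intro h_le) auto
    have "t (a, \<top>\<^bsub>M\<^esub>) = f a"
      using frame_mapD(4)[OF g] k.le_iff_meet[of "f a" "\<top>\<^bsub>K\<^esub>"] fc[OF a] by (simp add: t_def)
    then show "f a \<sqsubseteq>\<^bsub>K\<^esub> h (coproduct_inl L M a)"
      using h_upper[OF i inl_mem[OF a m.top_closed]] by simp
  qed (use a fc hc coproduct_ideal_inl in auto)
  moreover have "h (coproduct_inr L M b) = g b" if b: "b \<in> carrier M" for b
  proof (rule k.le_antisym)
    have i: "coproduct_ideal L M (coproduct_inr L M b)"
      using frame_mapD(1)[OF frame_map_inr b] by (simp add: carrier_frame_coproduct)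
    show "g b \<in> carrier K" "h (coproduct_inr L M b) \<in> carrier K" using b gc hc i by auto
    have "t p \<sqsubseteq>\<^bsub>K\<^esub> g b" if "p \<in> coproduct_inr L M b" for p
    proof -
      obtain x y where xy: "p = (x, y)" by fastforce
      have c: "x \<in> carrier L" "y \<in> carrier M" "x = \<bottom>\<^bsub>L\<^esub> \<or> y \<sqsubseteq>\<^bsub>M\<^esub> b"
        using that xy by (auto simp: coproduct_inr_def)
      show ?thesis
      proof (cases "x = \<bottom>\<^bsub>L\<^esub>")
        case True
        then show ?thesis
          using coproduct_ideal_bottom(2)[OF ideal[OF gc[OF b]], of y] c xy by simp
      next
        case False
        then have "g y \<sqsubseteq>\<^bsub>K\<^esub> g b" using frame_map_mono[OF g assms(2,3) c(2) b] c(3) by simp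
        then show ?thesis
          using k.le_trans[OF k.meet_right, of "f x" "g y" "g b"] fc[OF c(1)] gc[OF c(2)] gc[OF b] xy
          by (simp add: t_def)
      qed
    qed
    then show "h (coproduct_inr L M b) \<sqsubseteq>\<^bsub>K\<^esub> g b" using i b gc by (intro h_le) auto
    have "\<top>\<^bsub>K\<^esub> \<sqinter>\<^bsub>K\<^esub> g b = g b"
      using k.le_iff_meet[of "g b" "\<top>\<^bsub>K\<^esub>"] meet_comm[of K "g b" "\<top>\<^bsub>K\<^esub>"] gc[OF b] by simp
    then have "t (\<top>\<^bsub>L\<^esub>, b) = g b" using frame_mapD(4)[OF f] by (simp add: t_def)
    moreover have "(\<top>\<^bsub>L\<^esub>, b) \<in> coproduct_inr L M b" using b by (simp add: coproduct_inr_def)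
    ultimately show "g b \<sqsubseteq>\<^bsub>K\<^esub> h (coproduct_inr L M b)" using h_upper[OF i] by metis
  qed
  ultimately show "\<exists>h. frame_map ?C K h \<and>
      (\<forall>a\<in>carrier L. h (coproduct_inl L M a) = f a) \<and> (\<forall>b\<in>carrier M. h (coproduct_inr L M b) = g b)"
    using map by blast
  show "h I = h' I"
    if h: "frame_map ?C K h" and h': "frame_map ?C K h'"
      and l: "\<forall>a\<in>carrier L. h (coproduct_inl L M a) = h' (coproduct_inl L M a)"
      and r: "\<forall>b\<in>carrier M. h (coproduct_inr L M b) = h' (coproduct_inr L M b)"
      and I: "I \<in> carrier ?C" for h h'
  proof -
    let ?e = "\<lambda>(a, b). coproduct_inl L M a \<sqinter>\<^bsub>?C\<^esub> coproduct_inr L M b"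
    interpret c: frame ?C by (rule frame_frame_coproduct)
    have sub: "I \<subseteq> carrier L \<times> carrier M"
      using I coproduct_idealD(1) by (auto simp: carrier_frame_coproduct)
    note ic = frame_mapD(1)[OF frame_map_inl] frame_mapD(1)[OF frame_map_inr]
    have e: "?e ` I \<subseteq> carrier ?C" using sub ic by auto
    have "h (?e p) = h' (?e p)" if p: "p \<in> I" for p
    proof -
      obtain a b where ab: "p = (a, b)" "a \<in> carrier L" "b \<in> carrier M" using p sub by (cases p) auto
      then show ?thesis using l r frame_mapD(3)[OF h] frame_mapD(3)[OF h'] ic by simp
    qed
    then have "h ` ?e ` I = h' ` ?e ` I" by (simp add: image_image)
    then show ?thesis
      using frame_mapD(2)[OF h e] frame_mapD(2)[OF h' e] frame_coproduct_generated[OF I] by simp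
  qed
qed

subsection \<open>The quotient\<close>

locale frame_with_congruence = frame L for L (structure) +
  fixes r :: "('a \<times> 'a) set"
  assumes congruence: "frame_congruence L r"
begin

abbreviation cls :: "'a \<Rightarrow> 'a set" where "cls a \<equiv> r `` {a}"

lemma equiv: "equiv (carrier L) r"
  and cong_meet: "\<lbrakk>(a, b) \<in> r; (c, d) \<in> r\<rbrakk> \<Longrightarrow> (a \<sqinter> c, b \<sqinter> d) \<in> r"
  and cong_sup: "S \<subseteq> r \<Longrightarrow> (\<Squnion>(fst ` S), \<Squnion>(snd ` S)) \<in> r"
  using congruence unfolding frame_congruence_def by auto

lemma cong_refl: "a \<in> carrier L \<Longrightarrow> (a, a) \<in> r"
  using equiv by (auto simp: equiv_def refl_on_def)

lemma cong_sym: "(a, b) \<in> r \<Longrightarrow> (b, a) \<in> r"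
  using equiv by (auto simp: equiv_def sym_def)

lemma cong_trans: "\<lbrakk>(a, b) \<in> r; (b, c) \<in> r\<rbrakk> \<Longrightarrow> (a, c) \<in> r"
  using equiv unfolding equiv_def trans_def by blast

lemma cong_closed: "(a, b) \<in> r \<Longrightarrow> a \<in> carrier L" "(a, b) \<in> r \<Longrightarrow> b \<in> carrier L"
  using equiv_class_eq_iff[OF equiv, of a b] by auto

lemma cls_eq_iff: "\<lbrakk>a \<in> carrier L; b \<in> carrier L\<rbrakk> \<Longrightarrow> cls a = cls b \<longleftrightarrow> (a, b) \<in> r"
  by (rule eq_equiv_class_iff[OF equiv])

lemma carrier_frame_quotient: "carrier (frame_quotient L r) = cls ` carrier L"
  by (auto simp: frame_quotient_def quotient_def)

lemma eq_frame_quotient: "eq (frame_quotient L r) = (=)"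
  by (simp add: frame_quotient_def)

lemma le_cls:
  assumes a: "a \<in> carrier L" and b: "b \<in> carrier L"
  shows "cls a \<sqsubseteq>\<^bsub>frame_quotient L r\<^esub> cls b \<longleftrightarrow> (a \<sqinter> b, a) \<in> r"
proof
  assume "cls a \<sqsubseteq>\<^bsub>frame_quotient L r\<^esub> cls b"
  then obtain a' b' where ab: "(a, a') \<in> r" "(b, b') \<in> r" "a' \<sqsubseteq> b'"
    by (auto simp: frame_quotient_def)
  have "a' \<sqinter> b' = a'" using ab cong_closed le_iff_meet by blast
  then have "(a \<sqinter> b, a') \<in> r" using cong_meet[OF ab(1,2)] by simp
  then show "(a \<sqinter> b, a) \<in> r" using cong_trans cong_sym[OF ab(1)] by blast
next
  assume "(a \<sqinter> b, a) \<in> r"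
  then have "a \<sqinter> b \<in> cls a" using cong_sym by simp
  moreover have "b \<in> cls b" using cong_refl b by simp
  ultimately show "cls a \<sqsubseteq>\<^bsub>frame_quotient L r\<^esub> cls b"
    unfolding frame_quotient_def using meet_right[OF a b] by auto
qed

lemma partial_order_frame_quotient: "partial_order (frame_quotient L r)" (is "partial_order ?Q")
proof
  fix x assume "x \<in> carrier ?Q"
  then obtain a where a: "a \<in> carrier L" "x = cls a" by (auto simp: carrier_frame_quotient)
  have "a \<sqinter> a = a" using le_iff_meet[OF a(1) a(1)] a by simp
  then show "x \<sqsubseteq>\<^bsub>?Q\<^esub> x" using a le_cls[OF a(1) a(1)] cong_refl by simp
next
  fix x y assume xy: "x \<sqsubseteq>\<^bsub>?Q\<^esub> y" "y \<sqsubseteq>\<^bsub>?Q\<^esub> x" "x \<in> carrier ?Q" "y \<in> carrier ?Q"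
  then obtain a b where a: "a \<in> carrier L" "x = cls a" and b: "b \<in> carrier L" "y = cls b"
    by (auto simp: carrier_frame_quotient)
  have "(a \<sqinter> b, a) \<in> r" "(b \<sqinter> a, b) \<in> r"
    using xy le_cls[OF a(1) b(1)] le_cls[OF b(1) a(1)] a b by auto
  then have "(a, b) \<in> r" using cong_trans cong_sym meet_comm[of L a b] by metis
  then show "x .=\<^bsub>?Q\<^esub> y" using a b cls_eq_iff by (simp add: eq_frame_quotient)
next
  fix x y z assume xyz: "x \<sqsubseteq>\<^bsub>?Q\<^esub> y" "y \<sqsubseteq>\<^bsub>?Q\<^esub> z" "x \<in> carrier ?Q" "y \<in> carrier ?Q" "z \<in> carrier ?Q"
  then obtain a b c where a: "a \<in> carrier L" "x = cls a" and b: "b \<in> carrier L" "y = cls b"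
    and c: "c \<in> carrier L" "z = cls c"
    by (auto simp: carrier_frame_quotient)
  have ab: "(a \<sqinter> b, a) \<in> r" and bc: "(b \<sqinter> c, b) \<in> r"
    using xyz le_cls[OF a(1) b(1)] le_cls[OF b(1) c(1)] a b c by auto
  have "(a \<sqinter> (b \<sqinter> c), a \<sqinter> b) \<in> r" by (rule cong_meet[OF cong_refl[OF a(1)] bc])
  then have 1: "(a \<sqinter> (b \<sqinter> c), a) \<in> r" using ab by (rule cong_trans)
  have "((a \<sqinter> b) \<sqinter> c, a \<sqinter> c) \<in> r" by (rule cong_meet[OF ab cong_refl[OF c(1)]])
  then have "(a \<sqinter> (b \<sqinter> c), a \<sqinter> c) \<in> r" using meet_assoc a b c by simp
  then have "(a \<sqinter> c, a) \<in> r" using 1 cong_trans cong_sym by blast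
  then show "x \<sqsubseteq>\<^bsub>?Q\<^esub> z" using a c le_cls by simp
qed (simp_all add: eq_frame_quotient)

lemma cong_Union_cls:
  assumes "A \<subseteq> carrier L"
  shows "(\<Squnion>(\<Union>(cls ` A)), \<Squnion>A) \<in> r"
proof -
  let ?S = "{(b, a). a \<in> A \<and> (a, b) \<in> r}"
  have "?S \<subseteq> r" using cong_sym by auto
  from cong_sup[OF this] have "(\<Squnion>(fst ` ?S), \<Squnion>(snd ` ?S)) \<in> r" .
  moreover have "fst ` ?S = \<Union>(cls ` A)" by (auto simp: image_iff)
  moreover have "snd ` ?S = A"
  proof
    show "A \<subseteq> snd ` ?S"
    proof
      fix a assume "a \<in> A"
      then have "(a, a) \<in> ?S" using cong_refl assms by auto
      then show "a \<in> snd ` ?S" by (rule image_eqI[rotated]) simp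
    qed
  qed auto
  ultimately show ?thesis by simp
qed

lemma frame_frame_quotient: "frame (frame_quotient L r)"
  and sup_cls: "A \<subseteq> carrier L \<Longrightarrow> \<Squnion>\<^bsub>frame_quotient L r\<^esub>(cls ` A) = cls (\<Squnion>A)"
  and meet_cls: "\<lbrakk>a \<in> carrier L; b \<in> carrier L\<rbrakk> \<Longrightarrow> cls a \<sqinter>\<^bsub>frame_quotient L r\<^esub> cls b = cls (a \<sqinter> b)"
proof -
  let ?Q = "frame_quotient L r"
  define S where "S Q = cls (\<Squnion>(\<Union>Q))" for Q
  define rep where "rep C = (SOME a. a \<in> C)" for C :: "'a set"
  define m where "m C D = cls (rep C \<sqinter> rep D)" for C D
  have rep: "(a, rep (cls a)) \<in> r" if "a \<in> carrier L" for a
    using someI[of "\<lambda>x. x \<in> cls a" a] cong_refl[OF that] by (simp add: rep_def)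
  have S: "S (cls ` A) = cls (\<Squnion>A)" if "A \<subseteq> carrier L" for A
    using cls_eq_iff[OF cong_closed[OF cong_Union_cls[OF that]]] cong_Union_cls[OF that]
    by (simp add: S_def)
  have m: "m (cls a) (cls b) = cls (a \<sqinter> b)" if "a \<in> carrier L" "b \<in> carrier L" for a b
  proof -
    have "(rep (cls a) \<sqinter> rep (cls b), a \<sqinter> b) \<in> r"
      by (rule cong_sym[OF cong_meet[OF rep[OF that(1)] rep[OF that(2)]]])
    then show ?thesis using cls_eq_iff cong_closed unfolding m_def by blast
  qed
  have sub: "\<exists>B\<subseteq>carrier L. A = cls ` B" if "A \<subseteq> carrier ?Q" for A
    using that unfolding carrier_frame_quotient by (auto simp: subset_image_iff)
  have 1: "S A \<in> carrier ?Q" if "A \<subseteq> carrier ?Q" for A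
    using sub[OF that] S by (auto simp: carrier_frame_quotient)
  have 2: "a \<sqsubseteq>\<^bsub>?Q\<^esub> S A" if A: "A \<subseteq> carrier ?Q" and a: "a \<in> A" for A a
  proof -
    obtain B where B: "B \<subseteq> carrier L" "A = cls ` B" using sub[OF A] by blast
    obtain b where b: "b \<in> B" "a = cls b" using a B by blast
    have "b \<sqinter> \<Squnion>B = b"
      using le_iff_meet[of b "\<Squnion>B"] B b weak.sup_upper[OF B(1) b(1)] by auto
    then show ?thesis using le_cls[of b "\<Squnion>B"] B b cong_refl[of b] S[OF B(1)] by auto
  qed
  have 3: "S A \<sqsubseteq>\<^bsub>?Q\<^esub> u" if A: "A \<subseteq> carrier ?Q" and u: "u \<in> carrier ?Q" and le: "\<forall>a\<in>A. a \<sqsubseteq>\<^bsub>?Q\<^esub> u" for A u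
  proof -
    obtain B where B: "B \<subseteq> carrier L" "A = cls ` B" using sub[OF A] by blast
    obtain c where c: "c \<in> carrier L" "u = cls c" using u by (auto simp: carrier_frame_quotient)
    let ?S = "(\<lambda>b. (c \<sqinter> b, b)) ` B"
    have "(c \<sqinter> b, b) \<in> r" if "b \<in> B" for b
      using le[unfolded B(2) c(2)] that le_cls[of b c] B c meet_comm[of L b c] by auto
    then have "?S \<subseteq> r" by auto
    from cong_sup[OF this] have "(\<Squnion>((\<lambda>b. c \<sqinter> b) ` B), \<Squnion>B) \<in> r" by (simp add: image_image)
    then have "(\<Squnion>B \<sqinter> c, \<Squnion>B) \<in> r" using meet_sup_distrib[OF c(1) B(1)] meet_comm[of L "\<Squnion>B" c] by simp
    then show ?thesis using le_cls[of "\<Squnion>B" c] B c S[OF B(1)] by simp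
  qed
  have 4: "m x y \<in> carrier ?Q" "m x y \<sqsubseteq>\<^bsub>?Q\<^esub> x" "m x y \<sqsubseteq>\<^bsub>?Q\<^esub> y"
    if x: "x \<in> carrier ?Q" and y: "y \<in> carrier ?Q" for x y
  proof -
    obtain a b where a: "a \<in> carrier L" "x = cls a" and b: "b \<in> carrier L" "y = cls b"
      using x y by (auto simp: carrier_frame_quotient)
    have ab: "a \<sqinter> b \<in> carrier L" using a b by simp
    have "(a \<sqinter> b) \<sqinter> a = a \<sqinter> b" "(a \<sqinter> b) \<sqinter> b = a \<sqinter> b"
      using le_iff_meet[OF ab a(1)] le_iff_meet[OF ab b(1)] meet_left[OF a(1) b(1)] meet_right[OF a(1) b(1)]
      by auto
    then show "m x y \<sqsubseteq>\<^bsub>?Q\<^esub> x" "m x y \<sqsubseteq>\<^bsub>?Q\<^esub> y"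
      using le_cls[OF ab a(1)] le_cls[OF ab b(1)] cong_refl[OF ab] m[OF a(1) b(1)] a b by auto
    show "m x y \<in> carrier ?Q" using ab m[OF a(1) b(1)] a b by (simp add: carrier_frame_quotient)
  qed
  have 5: "u \<sqsubseteq>\<^bsub>?Q\<^esub> m x y"
    if x: "x \<in> carrier ?Q" and y: "y \<in> carrier ?Q" and u: "u \<in> carrier ?Q" and le: "u \<sqsubseteq>\<^bsub>?Q\<^esub> x" "u \<sqsubseteq>\<^bsub>?Q\<^esub> y" for x y u
  proof -
    obtain a b c where a: "a \<in> carrier L" "x = cls a" and b: "b \<in> carrier L" "y = cls b"
      and c: "c \<in> carrier L" "u = cls c"
      using x y u by (auto simp: carrier_frame_quotient)
    have ca: "(c \<sqinter> a, c) \<in> r" and cb: "(c \<sqinter> b, c) \<in> r"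
      using le le_cls[OF c(1) a(1)] le_cls[OF c(1) b(1)] a b c by auto
    have "((c \<sqinter> a) \<sqinter> b, c \<sqinter> b) \<in> r" by (rule cong_meet[OF ca cong_refl[OF b(1)]])
    then have "(c \<sqinter> (a \<sqinter> b), c) \<in> r" using cong_trans[OF _ cb] meet_assoc a b c by simp
    then show ?thesis using le_cls[of c "a \<sqinter> b"] a b c m by simp
  qed
  have 6: "m x (S A) \<sqsubseteq>\<^bsub>?Q\<^esub> S (m x ` A)" if x: "x \<in> carrier ?Q" and A: "A \<subseteq> carrier ?Q" for x A
  proof -
    obtain B where B: "B \<subseteq> carrier L" "A = cls ` B" using sub[OF A] by blast
    obtain a where a: "a \<in> carrier L" "x = cls a" using x by (auto simp: carrier_frame_quotient)
    have im: "m x ` A = cls ` ((\<lambda>b. a \<sqinter> b) ` B)"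
      unfolding a(2) B(2) image_image by (rule image_cong) (use m[OF a(1)] B in auto)
    have "(\<lambda>b. a \<sqinter> b) ` B \<subseteq> carrier L" using a B by auto
    then have "S (m x ` A) = m x (S A)"
      unfolding im using S[OF B(1)] S meet_sup_distrib[OF a(1) B(1)] m[OF a(1), of "\<Squnion>B"] a B by simp
    then show ?thesis
      using partial_order_frame_quotient 4(1)[OF x 1[OF A]]
      by (simp add: partial_order_def weak_partial_order.le_refl)
  qed
  note d = frame_criterion[OF partial_order_frame_quotient 1 2 3 4 5 6]
  show "frame ?Q" by (rule d; assumption)
  show "\<Squnion>\<^bsub>?Q\<^esub>(cls ` A) = cls (\<Squnion>A)" if "A \<subseteq> carrier L"
  proof -
    have "cls ` A \<subseteq> carrier ?Q" using that by (auto simp: carrier_frame_quotient)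
    then have "\<Squnion>\<^bsub>?Q\<^esub>(cls ` A) = S (cls ` A)"
      by - (rule d; assumption)
    then show ?thesis using S[OF that] by simp
  qed
  show "cls a \<sqinter>\<^bsub>?Q\<^esub> cls b = cls (a \<sqinter> b)" if "a \<in> carrier L" "b \<in> carrier L"
  proof -
    have "cls a \<in> carrier ?Q" "cls b \<in> carrier ?Q" using that by (auto simp: carrier_frame_quotient)
    then have "cls a \<sqinter>\<^bsub>?Q\<^esub> cls b = m (cls a) (cls b)"
      by - (rule d; assumption)
    then show ?thesis using m[OF that] by simp
  qed
qed

lemma frame_map_cls: "frame_map L (frame_quotient L r) cls"
proof (rule frame_mapI[OF frame_axioms frame_frame_quotient])
  show "cls \<top> = \<top>\<^bsub>frame_quotient L r\<^esub>"
  proof (rule is_greatest_imp_top[symmetric])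
    show "complete_lattice (frame_quotient L r)" using frame_frame_quotient by (simp add: frame_def)
    fix u assume "u \<in> carrier (frame_quotient L r)"
    then obtain a where a: "a \<in> carrier L" "u = cls a" by (auto simp: carrier_frame_quotient)
    then show "u \<sqsubseteq>\<^bsub>frame_quotient L r\<^esub> cls \<top>"
      using le_cls[of a \<top>] le_iff_meet[of a \<top>] cong_refl by simp
  qed (simp add: carrier_frame_quotient)
qed (simp_all add: carrier_frame_quotient sup_cls meet_cls)

lemma frame_quotient_universal:
  assumes "frame K" and f: "frame_map L K f" and ker: "\<And>a b. (a, b) \<in> r \<Longrightarrow> f a = f b"
  shows "\<exists>h. frame_map (frame_quotient L r) K h \<and> (\<forall>a\<in>carrier L. h (cls a) = f a)"
proof -
  define h where "h C = f (SOME a. a \<in> C)" for C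
  have h: "h (cls a) = f a" if "a \<in> carrier L" for a
    using someI[of "\<lambda>x. x \<in> cls a" a] cong_refl[OF that] ker[of a] by (simp add: h_def)
  have "frame_map (frame_quotient L r) K h"
  proof (rule frame_mapI[OF frame_frame_quotient assms(1)])
    show "h x \<in> carrier K" if "x \<in> carrier (frame_quotient L r)" for x
      using that h frame_mapD(1)[OF f] by (auto simp: carrier_frame_quotient)
  next
    fix A assume "A \<subseteq> carrier (frame_quotient L r)"
    then obtain B where B: "B \<subseteq> carrier L" "A = cls ` B"
      unfolding carrier_frame_quotient by (auto simp: subset_image_iff)
    have "h ` A = f ` B" unfolding B(2) image_image by (rule image_cong) (use B h in auto)
    then show "h (\<Squnion>\<^bsub>frame_quotient L r\<^esub>A) = \<Squnion>\<^bsub>K\<^esub>(h ` A)"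
      using sup_cls[OF B(1)] frame_mapD(2)[OF f B(1)] h[of "\<Squnion>B"] B by simp
  next
    fix x y assume "x \<in> carrier (frame_quotient L r)" "y \<in> carrier (frame_quotient L r)"
    then obtain a b where "a \<in> carrier L" "x = cls a" "b \<in> carrier L" "y = cls b"
      by (auto simp: carrier_frame_quotient)
    then show "h (x \<sqinter>\<^bsub>frame_quotient L r\<^esub> y) = h x \<sqinter>\<^bsub>K\<^esub> h y"
      using h meet_cls frame_mapD(3)[OF f] by simp
  next
    show "h \<top>\<^bsub>frame_quotient L r\<^esub> = \<top>\<^bsub>K\<^esub>"
      using frame_mapD(4)[OF frame_map_cls] frame_mapD(4)[OF f] h[of \<top>] by simp
  qed
  then show ?thesis using h by blast
qed

end

lemma frame_congruence_kernel:
  assumes "frame L" "frame K" and f: "frame_map L K f"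
  shows "frame_congruence L {(a, b). a \<in> carrier L \<and> b \<in> carrier L \<and> f a = f b}" (is "frame_congruence L ?r")
proof -
  interpret frame L by fact
  have "equiv (carrier L) ?r"
    by (rule equivI) (auto simp: refl_on_def sym_def trans_def)
  moreover have "(\<Squnion>\<^bsub>L\<^esub>(fst ` S), \<Squnion>\<^bsub>L\<^esub>(snd ` S)) \<in> ?r" if S: "S \<subseteq> ?r" for S
  proof -
    have c: "fst ` S \<subseteq> carrier L" "snd ` S \<subseteq> carrier L" using S by auto
    have "f ` fst ` S = f ` snd ` S"
      unfolding image_image by (rule image_cong) (use S in auto)
    then show ?thesis using frame_mapD(2)[OF f c(1)] frame_mapD(2)[OF f c(2)] c by simp
  qed
  ultimately show ?thesis
    unfolding frame_congruence_def using frame_mapD(3)[OF f] by auto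
qed

lemma frame_congruence_Times: "frame L \<Longrightarrow> frame_congruence L (carrier L \<times> carrier L)"
proof -
  assume "frame L"
  then interpret frame L .
  show ?thesis unfolding frame_congruence_def
  proof (intro conjI allI impI)
    show "equiv (carrier L) (carrier L \<times> carrier L)"
      by (rule equivI) (auto simp: refl_on_def sym_def trans_def)
    fix S assume "S \<subseteq> carrier L \<times> carrier L"
    then have "fst ` S \<subseteq> carrier L" "snd ` S \<subseteq> carrier L" by auto
    then show "(\<Squnion>\<^bsub>L\<^esub>(fst ` S), \<Squnion>\<^bsub>L\<^esub>(snd ` S)) \<in> carrier L \<times> carrier L" by simp
  qed auto
qed

lemma frame_congruence_Inter:
  assumes "\<F> \<noteq> {}" and F: "\<And>r. r \<in> \<F> \<Longrightarrow> frame_congruence L r"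
  shows "frame_congruence L (\<Inter>\<F>)"
proof -
  have e: "r \<subseteq> carrier L \<times> carrier L" "refl_on (carrier L) r" "sym r" "trans r" if "r \<in> \<F>" for r
    using F[OF that] by (auto simp: frame_congruence_def equiv_def)
  have m: "(a \<sqinter>\<^bsub>L\<^esub> c, b \<sqinter>\<^bsub>L\<^esub> d) \<in> r" if "r \<in> \<F>" "(a, b) \<in> r" "(c, d) \<in> r" for r a b c d
    using F[OF that(1)] that(2,3) by (auto simp: frame_congruence_def)
  have s: "(\<Squnion>\<^bsub>L\<^esub>(fst ` S), \<Squnion>\<^bsub>L\<^esub>(snd ` S)) \<in> r" if "r \<in> \<F>" "S \<subseteq> r" for r S
    using F[OF that(1)] that(2) by (simp add: frame_congruence_def)
  have "equiv (carrier L) (\<Inter>\<F>)"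
  proof (rule equivI)
    show "\<Inter>\<F> \<subseteq> carrier L \<times> carrier L" using assms(1) e(1) by (auto dest!: ex_in_conv[THEN iffD2])
    show "refl_on (carrier L) (\<Inter>\<F>)" using e(2) by (simp add: refl_on_def)
    show "sym (\<Inter>\<F>)" using e(3) by (simp add: sym_def)
    show "trans (\<Inter>\<F>)"
    proof (rule transI, rule InterI)
      fix x y z r assume h: "(x, y) \<in> \<Inter>\<F>" "(y, z) \<in> \<Inter>\<F>" "r \<in> \<F>"
      from InterD[OF h(1,3)] InterD[OF h(2,3)] show "(x, z) \<in> r" by (rule transD[OF e(4)[OF h(3)]])
    qed
  qed
  moreover have "(a \<sqinter>\<^bsub>L\<^esub> c, b \<sqinter>\<^bsub>L\<^esub> d) \<in> \<Inter>\<F>" if "(a, b) \<in> \<Inter>\<F>" "(c, d) \<in> \<Inter>\<F>" for a b c d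
    using that by (intro InterI m) simp_all
  moreover have "(\<Squnion>\<^bsub>L\<^esub>(fst ` S), \<Squnion>\<^bsub>L\<^esub>(snd ` S)) \<in> \<Inter>\<F>" if "S \<subseteq> \<Inter>\<F>" for S
    using that by (intro InterI s) (simp_all add: le_Inf_iff)
  ultimately show ?thesis unfolding frame_congruence_def by auto
qed

lemma frame_congruence_imposed:
  assumes "frame L" "R \<subseteq> carrier L \<times> carrier L"
  shows "frame_congruence L (imposed_congruence L R)"
    and "(a, b) \<in> R \<Longrightarrow> (a \<sqinter>\<^bsub>L\<^esub> b, a) \<in> imposed_congruence L R"
proof -
  interpret frame L by fact
  have c: "a \<in> carrier L" "b \<in> carrier L" if "(a, b) \<in> R" for a b using that assms(2) by auto
  have "frame_congruence L (carrier L \<times> carrier L) \<and> (\<forall>(a, b) \<in> R. (a \<sqinter>\<^bsub>L\<^esub> b, a) \<in> carrier L \<times> carrier L)"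
    using frame_congruence_Times[OF assms(1)] c by auto
  then show "frame_congruence L (imposed_congruence L R)"
    unfolding imposed_congruence_def by (intro frame_congruence_Inter) auto
  show "(a \<sqinter>\<^bsub>L\<^esub> b, a) \<in> imposed_congruence L R" if "(a, b) \<in> R"
    unfolding imposed_congruence_def using that by auto
qed

lemma imposed_congruence_kernel:
  assumes "frame L" "frame K" and f: "frame_map L K f" and R: "R \<subseteq> carrier L \<times> carrier L"
    and le: "\<And>a b. (a, b) \<in> R \<Longrightarrow> f a \<sqsubseteq>\<^bsub>K\<^esub> f b"
    and ab: "(a, b) \<in> imposed_congruence L R"
  shows "f a = f b"
proof -
  interpret frame L by fact
  have "f (c \<sqinter>\<^bsub>L\<^esub> d) = f c" "c \<in> carrier L" "d \<in> carrier L" if "(c, d) \<in> R" for c d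
    using that R le[OF that] frame.le_iff_meet[OF assms(2)] frame_mapD(1,3)[OF f] by auto
  then have "imposed_congruence L R \<subseteq> {(a, b). a \<in> carrier L \<and> b \<in> carrier L \<and> f a = f b}"
    unfolding imposed_congruence_def
    by (intro Inter_lower CollectI conjI frame_congruence_kernel[OF assms(1,2) f]) auto
  then show ?thesis using ab by blast
qed

section \<open>Biframes\<close>

record ('p, 'n, 't) biframe =
  pos_frame :: "'p gorder"
  neg_frame :: "'n gorder"
  total_frame :: "'t gorder"
  pos_emb :: "'p \<Rightarrow> 't"
  neg_emb :: "'n \<Rightarrow> 't"

definition is_biframe :: "('p, 'n, 't) biframe \<Rightarrow> bool" where
  "is_biframe B \<longleftrightarrow>
     frame (pos_frame B) \<and> frame (neg_frame B) \<and> frame (total_frame B) \<and>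
     frame_map (pos_frame B) (total_frame B) (pos_emb B) \<and>
     frame_map (neg_frame B) (total_frame B) (neg_emb B) \<and>
     inj_on (pos_emb B) (carrier (pos_frame B)) \<and>
     inj_on (neg_emb B) (carrier (neg_frame B)) \<and>
     (\<forall>c \<in> carrier (total_frame B).
        \<exists>S \<subseteq> carrier (pos_frame B) \<times> carrier (neg_frame B).
          c = \<Squnion>\<^bsub>total_frame B\<^esub> ((\<lambda>(x, y). pos_emb B x \<sqinter>\<^bsub>total_frame B\<^esub> neg_emb B y) ` S))"

definition biframe_map ::
    "('p, 'n, 't) biframe \<Rightarrow> ('q, 'm, 's) biframe \<Rightarrow> ('p \<Rightarrow> 'q) \<times> ('n \<Rightarrow> 'm) \<Rightarrow> bool" where
  "biframe_map B C = (\<lambda>(fp, fn).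
     frame_map (pos_frame B) (pos_frame C) fp \<and>
     frame_map (neg_frame B) (neg_frame C) fn \<and>
     (\<exists>f. frame_map (total_frame B) (total_frame C) f \<and>
        (\<forall>a \<in> carrier (pos_frame B). f (pos_emb B a) = pos_emb C (fp a)) \<and>
        (\<forall>a \<in> carrier (neg_frame B). f (neg_emb B a) = neg_emb C (fn a))))"

definition two_biframe :: "(bool, bool, bool) biframe" where
  "two_biframe = \<lparr>pos_frame = two_frame, neg_frame = two_frame, total_frame = two_frame,
     pos_emb = id, neg_emb = id\<rparr>"

section \<open>Bispaces\<close>

record 'a bispace =
  pos_top :: "'a topology"
  neg_top :: "'a topology"

definition is_bispace :: "'a bispace \<Rightarrow> bool" where
  "is_bispace X \<longleftrightarrow> topspace (pos_top X) = topspace (neg_top X)"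

definition pairwise_hausdorff :: "'a bispace \<Rightarrow> bool" where
  "pairwise_hausdorff X \<longleftrightarrow>
     (\<forall>x \<in> topspace (pos_top X). \<forall>y \<in> topspace (pos_top X). x \<noteq> y \<longrightarrow>
        (\<exists>U V. openin (pos_top X) U \<and> openin (neg_top X) V \<and> disjnt U V \<and> x \<in> U \<and> y \<in> V) \<or>
        (\<exists>U V. openin (pos_top X) U \<and> openin (neg_top X) V \<and> disjnt U V \<and> y \<in> U \<and> x \<in> V))"

definition bihomeomorphism :: "'a bispace \<Rightarrow> 'b bispace \<Rightarrow> ('a \<Rightarrow> 'b) \<Rightarrow> bool" where
  "bihomeomorphism X Y f \<longleftrightarrow>
     homeomorphic_map (pos_top X) (pos_top Y) f \<and> homeomorphic_map (neg_top X) (neg_top Y) f"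

subsection \<open>The bispace of points of a biframe\<close>

text \<open>Two maps are the same point when they agree on the carriers, so points are required to be
  extensional, that is, \<^const>\<open>undefined\<close> outside the carriers.\<close>

definition bpoints :: "('p, 'n, 't) biframe \<Rightarrow> (('p \<Rightarrow> bool) \<times> ('n \<Rightarrow> bool)) set" where
  "bpoints B = {f \<in> extensional (carrier (pos_frame B)) \<times> extensional (carrier (neg_frame B)).
     biframe_map B two_biframe f}"

definition bpt :: "('p, 'n, 't) biframe \<Rightarrow> (('p \<Rightarrow> bool) \<times> ('n \<Rightarrow> bool)) bispace" where
  "bpt B =
     \<lparr>pos_top = topology (\<lambda>S. \<exists>a \<in> carrier (pos_frame B). S = {f \<in> bpoints B. fst f a}),
      neg_top = topology (\<lambda>S. \<exists>a \<in> carrier (neg_frame B). S = {f \<in> bpoints B. snd f a})\<rparr>"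

subsection \<open>The biframe of a bispace and bisobriety\<close>

definition Omega_coproduct :: "'a bispace \<Rightarrow> ('a set \<times> 'a set) set gorder" where
  "Omega_coproduct X = frame_coproduct (open_frame (pos_top X)) (open_frame (neg_top X))"

definition Omega_inl :: "'a bispace \<Rightarrow> 'a set \<Rightarrow> ('a set \<times> 'a set) set" where
  "Omega_inl X = coproduct_inl (open_frame (pos_top X)) (open_frame (neg_top X))"

definition Omega_inr :: "'a bispace \<Rightarrow> 'a set \<Rightarrow> ('a set \<times> 'a set) set" where
  "Omega_inr X = coproduct_inr (open_frame (pos_top X)) (open_frame (neg_top X))"

definition fin_relations ::
    "'a bispace \<Rightarrow> (('a set \<times> 'a set) set \<times> ('a set \<times> 'a set) set) set" where
  "fin_relations X =
     {(Omega_inl X U \<sqinter>\<^bsub>Omega_coproduct X\<^esub> Omega_inr X V,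
       Omega_inl X U' \<squnion>\<^bsub>Omega_coproduct X\<^esub> Omega_inr X V') | U V U' V'.
       openin (pos_top X) U \<and> openin (neg_top X) V \<and>
       openin (pos_top X) U' \<and> openin (neg_top X) V' \<and> U \<inter> V \<subseteq> U' \<union> V'}"

definition fin_congruence ::
    "'a bispace \<Rightarrow> (('a set \<times> 'a set) set \<times> ('a set \<times> 'a set) set) set" where
  "fin_congruence X = imposed_congruence (Omega_coproduct X) (fin_relations X)"

definition bOmega_fin :: "'a bispace \<Rightarrow> ('a set, 'a set, ('a set \<times> 'a set) set set) biframe" where
  "bOmega_fin X =
     \<lparr>pos_frame = open_frame (pos_top X),
      neg_frame = open_frame (neg_top X),
      total_frame = frame_quotient (Omega_coproduct X) (fin_congruence X),
      pos_emb = (\<lambda>U. fin_congruence X `` {Omega_inl X U}),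
      neg_emb = (\<lambda>V. fin_congruence X `` {Omega_inr X V})\<rparr>"

definition neighbourhood_point :: "'a bispace \<Rightarrow> 'a \<Rightarrow> ('a set \<Rightarrow> bool) \<times> ('a set \<Rightarrow> bool)" where
  "neighbourhood_point X x =
     (\<lambda>U \<in> {U. openin (pos_top X) U}. x \<in> U, \<lambda>V \<in> {V. openin (neg_top X) V}. x \<in> V)"

definition bisober :: "'a bispace \<Rightarrow> bool" where
  "bisober X \<longleftrightarrow> bihomeomorphism X (bpt (bOmega_fin X)) (neighbourhood_point X)"

subsection \<open>Well-definedness of the constructions\<close>

lemma istopology_points:
  assumes "frame L" and P: "\<And>p. p \<in> P \<Longrightarrow> frame_map L two_frame (\<phi> p)"
  shows "istopology (\<lambda>S. \<exists>a \<in> carrier L. S = {p \<in> P. \<phi> p a})"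
  unfolding istopology_def
proof (intro conjI allI impI)
  interpret frame L by fact
  fix S T assume "\<exists>a \<in> carrier L. S = {p \<in> P. \<phi> p a}" "\<exists>a \<in> carrier L. T = {p \<in> P. \<phi> p a}"
  then obtain a b where ab: "a \<in> carrier L" "b \<in> carrier L" "S = {p \<in> P. \<phi> p a}" "T = {p \<in> P. \<phi> p b}"
    by blast
  have "\<phi> p (a \<sqinter>\<^bsub>L\<^esub> b) \<longleftrightarrow> \<phi> p a \<and> \<phi> p b" if "p \<in> P" for p
    using frame_mapD(3)[OF P[OF that] ab(1,2)] by (simp add: meet_two_frame)
  then have "S \<inter> T = {p \<in> P. \<phi> p (a \<sqinter>\<^bsub>L\<^esub> b)}" using ab by auto
  then show "\<exists>a \<in> carrier L. S \<inter> T = {p \<in> P. \<phi> p a}" using ab by (meson meet_closed)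
next
  interpret frame L by fact
  fix \<K> assume K: "\<forall>S\<in>\<K>. \<exists>a \<in> carrier L. S = {p \<in> P. \<phi> p a}"
  define A where "A = {a \<in> carrier L. {p \<in> P. \<phi> p a} \<in> \<K>}"
  have A: "A \<subseteq> carrier L" by (auto simp: A_def)
  have "\<phi> p (\<Squnion>\<^bsub>L\<^esub>A) \<longleftrightarrow> (\<exists>a\<in>A. \<phi> p a)" if "p \<in> P" for p
    using frame_mapD(2)[OF P[OF that] A] by (simp add: sup_two_frame)
  moreover have "\<Union>\<K> = (\<Union>a\<in>A. {p \<in> P. \<phi> p a})"
  proof
    show "\<Union>\<K> \<subseteq> (\<Union>a\<in>A. {p \<in> P. \<phi> p a})"
    proof
      fix p assume "p \<in> \<Union>\<K>"
      then obtain S where S: "S \<in> \<K>" "p \<in> S" by blast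
      then obtain a where "a \<in> carrier L" "S = {p \<in> P. \<phi> p a}" using K by blast
      then show "p \<in> (\<Union>a\<in>A. {p \<in> P. \<phi> p a})" using S by (auto simp: A_def)
    qed
  qed (auto simp: A_def)
  ultimately have "\<Union>\<K> = {p \<in> P. \<phi> p (\<Squnion>\<^bsub>L\<^esub>A)}" by auto
  then show "\<exists>a \<in> carrier L. \<Union>\<K> = {p \<in> P. \<phi> p a}" using A weak.sup_closed by blast
qed

lemma bpointsD:
  assumes "f \<in> bpoints B"
  shows "frame_map (pos_frame B) two_frame (fst f)" "frame_map (neg_frame B) two_frame (snd f)"
  using assms by (auto simp: bpoints_def biframe_map_def two_biframe_def)

lemma openin_pos_bpt:
  assumes "frame (pos_frame B)"
  shows "openin (pos_top (bpt B)) S \<longleftrightarrow> (\<exists>a \<in> carrier (pos_frame B). S = {f \<in> bpoints B. fst f a})"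
  using istopology_points[of "pos_frame B" "bpoints B" fst] assms bpointsD(1)[of _ B]
  by (simp add: bpt_def topology_inverse')

lemma openin_neg_bpt:
  assumes "frame (neg_frame B)"
  shows "openin (neg_top (bpt B)) S \<longleftrightarrow> (\<exists>a \<in> carrier (neg_frame B). S = {f \<in> bpoints B. snd f a})"
  using istopology_points[of "neg_frame B" "bpoints B" snd] assms bpointsD(2)[of _ B]
  by (simp add: bpt_def topology_inverse')

lemma topspace_bpt:
  assumes "frame (pos_frame B)" "frame (neg_frame B)"
  shows "topspace (pos_top (bpt B)) = bpoints B" "topspace (neg_top (bpt B)) = bpoints B"
proof -
  interpret p: frame "pos_frame B" by fact
  interpret n: frame "neg_frame B" by fact
  have "{f \<in> bpoints B. fst f \<top>\<^bsub>pos_frame B\<^esub>} = bpoints B" "{f \<in> bpoints B. snd f \<top>\<^bsub>neg_frame B\<^esub>} = bpoints B"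
    using frame_mapD(4)[OF bpointsD(1)] frame_mapD(4)[OF bpointsD(2)] top_two_frame by auto
  then have o: "openin (pos_top (bpt B)) (bpoints B)" "openin (neg_top (bpt B)) (bpoints B)"
    unfolding openin_pos_bpt[OF assms(1)] openin_neg_bpt[OF assms(2)]
    by (blast intro: p.top_closed n.top_closed sym)+
  have "topspace (pos_top (bpt B)) \<subseteq> bpoints B" "topspace (neg_top (bpt B)) \<subseteq> bpoints B"
    using openin_topspace[of "pos_top (bpt B)"] openin_topspace[of "neg_top (bpt B)"]
    unfolding openin_pos_bpt[OF assms(1)] openin_neg_bpt[OF assms(2)] by auto
  then show "topspace (pos_top (bpt B)) = bpoints B" "topspace (neg_top (bpt B)) = bpoints B"
    using o[THEN openin_subset] by auto
qed

lemma is_bispace_bpt: "is_biframe B \<Longrightarrow> is_bispace (bpt B)"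
  by (simp add: is_biframe_def is_bispace_def topspace_bpt)

lemma two_frames_Omega: "two_frames (open_frame (pos_top X)) (open_frame (neg_top X))"
  by (simp add: two_frames_def frame_open_frame)

lemma frame_Omega_coproduct: "frame (Omega_coproduct X)"
  unfolding Omega_coproduct_def by (rule two_frames.frame_frame_coproduct[OF two_frames_Omega])

lemma frame_map_Omega_inl: "frame_map (open_frame (pos_top X)) (Omega_coproduct X) (Omega_inl X)"
  unfolding Omega_coproduct_def Omega_inl_def by (rule two_frames.frame_map_inl[OF two_frames_Omega])

lemma frame_map_Omega_inr: "frame_map (open_frame (neg_top X)) (Omega_coproduct X) (Omega_inr X)"
  unfolding Omega_coproduct_def Omega_inr_def by (rule two_frames.frame_map_inr[OF two_frames_Omega])

lemma openin_carrier: "openin T U \<longleftrightarrow> U \<in> carrier (open_frame T)"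
  by (simp add: open_frame_def)

lemma fin_relations_subset:
  "fin_relations X \<subseteq> carrier (Omega_coproduct X) \<times> carrier (Omega_coproduct X)"
proof -
  interpret frame "Omega_coproduct X" by (rule frame_Omega_coproduct)
  show ?thesis
    using frame_mapD(1)[OF frame_map_Omega_inl[of X]] frame_mapD(1)[OF frame_map_Omega_inr[of X]]
    unfolding fin_relations_def openin_carrier by auto
qed

lemma frame_congruence_fin: "frame_congruence (Omega_coproduct X) (fin_congruence X)"
  unfolding fin_congruence_def
  by (rule frame_congruence_imposed(1)[OF frame_Omega_coproduct fin_relations_subset])

lemma frame_with_congruence_fin: "frame_with_congruence (Omega_coproduct X) (fin_congruence X)"
  by (simp add: frame_with_congruence_def frame_with_congruence_axioms_def
      frame_Omega_coproduct frame_congruence_fin)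

lemma bOmega_fin_sel [simp]:
  "pos_frame (bOmega_fin X) = open_frame (pos_top X)"
  "neg_frame (bOmega_fin X) = open_frame (neg_top X)"
  "total_frame (bOmega_fin X) = frame_quotient (Omega_coproduct X) (fin_congruence X)"
  "pos_emb (bOmega_fin X) = (\<lambda>U. fin_congruence X `` {Omega_inl X U})"
  "neg_emb (bOmega_fin X) = (\<lambda>V. fin_congruence X `` {Omega_inr X V})"
  by (simp_all add: bOmega_fin_def)

lemma frame_total_bOmega_fin: "frame (total_frame (bOmega_fin X))"
  by (simp add: frame_with_congruence.frame_frame_quotient[OF frame_with_congruence_fin])

lemma frame_map_pos_emb:
  "frame_map (open_frame (pos_top X)) (total_frame (bOmega_fin X)) (pos_emb (bOmega_fin X))"
  using frame_map_comp[OF frame_map_Omega_inl frame_with_congruence.frame_map_cls[OF frame_with_congruence_fin]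
      frame_open_frame frame_with_congruence.frame_frame_quotient[OF frame_with_congruence_fin]]
  by (simp add: comp_def)

lemma frame_map_neg_emb:
  "frame_map (open_frame (neg_top X)) (total_frame (bOmega_fin X)) (neg_emb (bOmega_fin X))"
  using frame_map_comp[OF frame_map_Omega_inr frame_with_congruence.frame_map_cls[OF frame_with_congruence_fin]
      frame_open_frame frame_with_congruence.frame_frame_quotient[OF frame_with_congruence_fin]]
  by (simp add: comp_def)

lemma bOmega_fin_relation:
  assumes "openin (pos_top X) U" "openin (neg_top X) V" "openin (pos_top X) U'" "openin (neg_top X) V'"
    and "U \<inter> V \<subseteq> U' \<union> V'"
  shows "pos_emb (bOmega_fin X) U \<sqinter>\<^bsub>total_frame (bOmega_fin X)\<^esub> neg_emb (bOmega_fin X) V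
    \<sqsubseteq>\<^bsub>total_frame (bOmega_fin X)\<^esub>
    pos_emb (bOmega_fin X) U' \<squnion>\<^bsub>total_frame (bOmega_fin X)\<^esub> neg_emb (bOmega_fin X) V'"
proof -
  interpret frame_with_congruence "Omega_coproduct X" "fin_congruence X"
    by (rule frame_with_congruence_fin)
  let ?a = "Omega_inl X U \<sqinter>\<^bsub>Omega_coproduct X\<^esub> Omega_inr X V"
  let ?b = "Omega_inl X U' \<squnion>\<^bsub>Omega_coproduct X\<^esub> Omega_inr X V'"
  note c = frame_mapD(1)[OF frame_map_Omega_inl[of X]] frame_mapD(1)[OF frame_map_Omega_inr[of X]]
  note cc = c(1)[OF assms(1)[unfolded openin_carrier]] c(2)[OF assms(2)[unfolded openin_carrier]]
    c(1)[OF assms(3)[unfolded openin_carrier]] c(2)[OF assms(4)[unfolded openin_carrier]]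
  have ab: "(?a, ?b) \<in> fin_relations X" unfolding fin_relations_def using assms by blast
  have "(?a \<sqinter>\<^bsub>Omega_coproduct X\<^esub> ?b, ?a) \<in> fin_congruence X"
    unfolding fin_congruence_def
    by (rule frame_congruence_imposed(2)[OF frame_Omega_coproduct fin_relations_subset ab])
  then have "cls ?a \<sqsubseteq>\<^bsub>total_frame (bOmega_fin X)\<^esub> cls ?b"
    using le_cls[of ?a ?b] cc by simp
  moreover have "cls ?a = pos_emb (bOmega_fin X) U \<sqinter>\<^bsub>total_frame (bOmega_fin X)\<^esub> neg_emb (bOmega_fin X) V"
    using meet_cls[OF cc(1,2)] by simp
  moreover have "cls ?b = pos_emb (bOmega_fin X) U' \<squnion>\<^bsub>total_frame (bOmega_fin X)\<^esub> neg_emb (bOmega_fin X) V'"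
    using frame_map_join[OF frame_map_cls cc(3,4)] by simp
  ultimately show ?thesis by simp
qed

lemma bOmega_fin_universal:
  assumes "frame K" "frame_map (open_frame (pos_top X)) K f" "frame_map (open_frame (neg_top X)) K g"
    and rel: "\<And>U V U' V'. \<lbrakk>openin (pos_top X) U; openin (neg_top X) V; openin (pos_top X) U';
      openin (neg_top X) V'; U \<inter> V \<subseteq> U' \<union> V'\<rbrakk> \<Longrightarrow> f U \<sqinter>\<^bsub>K\<^esub> g V \<sqsubseteq>\<^bsub>K\<^esub> f U' \<squnion>\<^bsub>K\<^esub> g V'"
  shows "\<exists>h. frame_map (total_frame (bOmega_fin X)) K h \<and>
    (\<forall>U. openin (pos_top X) U \<longrightarrow> h (pos_emb (bOmega_fin X) U) = f U) \<and>
    (\<forall>V. openin (neg_top X) V \<longrightarrow> h (neg_emb (bOmega_fin X) V) = g V)"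
proof -
  interpret frame_with_congruence "Omega_coproduct X" "fin_congruence X"
    by (rule frame_with_congruence_fin)
  obtain k where k: "frame_map (Omega_coproduct X) K k"
    and kl: "\<And>U. openin (pos_top X) U \<Longrightarrow> k (Omega_inl X U) = f U"
    and kr: "\<And>V. openin (neg_top X) V \<Longrightarrow> k (Omega_inr X V) = g V"
    using frame_coproduct_universal(1)[OF frame_open_frame frame_open_frame assms(1-3)]
    unfolding Omega_coproduct_def Omega_inl_def Omega_inr_def openin_carrier by blast
  note c = frame_mapD(1)[OF frame_map_Omega_inl[of X]] frame_mapD(1)[OF frame_map_Omega_inr[of X]]
  have "k a \<sqsubseteq>\<^bsub>K\<^esub> k b" if ab: "(a, b) \<in> fin_relations X" for a b
  proof -
    obtain U V U' V' where o: "openin (pos_top X) U" "openin (neg_top X) V" "openin (pos_top X) U'"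
      "openin (neg_top X) V'" "U \<inter> V \<subseteq> U' \<union> V'"
      and ab: "a = Omega_inl X U \<sqinter>\<^bsub>Omega_coproduct X\<^esub> Omega_inr X V"
        "b = Omega_inl X U' \<squnion>\<^bsub>Omega_coproduct X\<^esub> Omega_inr X V'"
      using ab unfolding fin_relations_def by blast
    note cc = c(1)[OF o(1)[unfolded openin_carrier]] c(2)[OF o(2)[unfolded openin_carrier]]
      c(1)[OF o(3)[unfolded openin_carrier]] c(2)[OF o(4)[unfolded openin_carrier]]
    have "k a = f U \<sqinter>\<^bsub>K\<^esub> g V"
      unfolding ab frame_mapD(3)[OF k cc(1,2)] using kl kr o by simp
    moreover have "k b = f U' \<squnion>\<^bsub>K\<^esub> g V'"
      unfolding ab frame_map_join[OF k cc(3,4)] using kl kr o by simp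
    ultimately show ?thesis using rel[OF o] by simp
  qed
  then have "k a = k b" if "(a, b) \<in> fin_congruence X" for a b
    using imposed_congruence_kernel[OF frame_Omega_coproduct assms(1) k fin_relations_subset]
      that unfolding fin_congruence_def by blast
  from frame_quotient_universal[OF assms(1) k this]
  obtain h where "frame_map (frame_quotient (Omega_coproduct X) (fin_congruence X)) K h"
    "\<And>a. a \<in> carrier (Omega_coproduct X) \<Longrightarrow> h (cls a) = k a"
    by blast
  then show ?thesis using kl kr c by (intro exI[of _ h]) (auto simp: openin_carrier)
qed

theorem is_biframe_bOmega_fin:
  assumes "is_bispace X"
  shows "is_biframe (bOmega_fin X)"
proof -
  interpret q: frame_with_congruence "Omega_coproduct X" "fin_congruence X"
    by (rule frame_with_congruence_fin)
  let ?K = "open_frame (discrete_topology (topspace (pos_top X)))"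
  have sub: "U \<subseteq> topspace (pos_top X)" if "openin (pos_top X) U \<or> openin (neg_top X) U" for U
    using that assms openin_subset unfolding is_bispace_def by metis
  have inc: "frame_map (open_frame T) ?K (\<lambda>U. U)" if "T = pos_top X \<or> T = neg_top X" for T
  proof (rule frame_mapI[OF frame_open_frame frame_open_frame])
    show c: "U \<in> carrier ?K" if "U \<in> carrier (open_frame T)" for U
      using that \<open>T = _ \<or> _\<close> sub by (auto simp: open_frame_def)
    show "\<Squnion>\<^bsub>open_frame T\<^esub>A = \<Squnion>\<^bsub>?K\<^esub>((\<lambda>U. U) ` A)" if "A \<subseteq> carrier (open_frame T)" for A
    proof -
      have "A \<subseteq> carrier ?K" using that c by blast
      from sup_open_frame[OF this] sup_open_frame[OF that] show ?thesis by simp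
    qed
    show "U \<sqinter>\<^bsub>open_frame T\<^esub> V = U \<sqinter>\<^bsub>?K\<^esub> V"
      if "U \<in> carrier (open_frame T)" "V \<in> carrier (open_frame T)" for U V
      using that c[OF that(1)] c[OF that(2)] unfolding openin_carrier[symmetric] by (simp add: meet_open_frame)
    show "\<top>\<^bsub>open_frame T\<^esub> = \<top>\<^bsub>?K\<^esub>"
      using that assms by (auto simp: top_open_frame is_bispace_def)
  qed
  have join: "U \<squnion>\<^bsub>?K\<^esub> V = U \<union> V" if "U \<subseteq> topspace (pos_top X)" "V \<subseteq> topspace (pos_top X)" for U V
    unfolding join_def by (subst sup_open_frame) (use that in \<open>auto simp: open_frame_def\<close>)
  have "\<exists>h. frame_map (total_frame (bOmega_fin X)) ?K h \<and>
    (\<forall>U. openin (pos_top X) U \<longrightarrow> h (pos_emb (bOmega_fin X) U) = U) \<and>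
    (\<forall>V. openin (neg_top X) V \<longrightarrow> h (neg_emb (bOmega_fin X) V) = V)"
  proof (rule bOmega_fin_universal[OF frame_open_frame])
    show "U \<sqinter>\<^bsub>?K\<^esub> V \<sqsubseteq>\<^bsub>?K\<^esub> U' \<squnion>\<^bsub>?K\<^esub> V'"
      if "openin (pos_top X) U" "openin (neg_top X) V" "openin (pos_top X) U'" "openin (neg_top X) V'"
        "U \<inter> V \<subseteq> U' \<union> V'" for U V U' V'
      using that join[of U' V'] sub by (simp add: meet_open_frame) (simp add: open_frame_def)
  qed (use inc in auto)
  then obtain h where h: "\<And>U. openin (pos_top X) U \<Longrightarrow> h (pos_emb (bOmega_fin X) U) = U"
    "\<And>V. openin (neg_top X) V \<Longrightarrow> h (neg_emb (bOmega_fin X) V) = V"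
    by blast
  have inj: "inj_on (pos_emb (bOmega_fin X)) (carrier (open_frame (pos_top X)))"
    "inj_on (neg_emb (bOmega_fin X)) (carrier (open_frame (neg_top X)))"
    using h by (metis inj_on_inverseI openin_carrier)+
  have gen: "\<exists>S \<subseteq> carrier (open_frame (pos_top X)) \<times> carrier (open_frame (neg_top X)).
      c = \<Squnion>\<^bsub>total_frame (bOmega_fin X)\<^esub> ((\<lambda>(x, y).
        pos_emb (bOmega_fin X) x \<sqinter>\<^bsub>total_frame (bOmega_fin X)\<^esub> neg_emb (bOmega_fin X) y) ` S)"
    if c: "c \<in> carrier (total_frame (bOmega_fin X))" for c
  proof -
    obtain I where I: "I \<in> carrier (Omega_coproduct X)" "c = q.cls I"
      using c q.carrier_frame_quotient by auto
    let ?e = "\<lambda>(x, y). Omega_inl X x \<sqinter>\<^bsub>Omega_coproduct X\<^esub> Omega_inr X y"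
    have sub: "I \<subseteq> carrier (open_frame (pos_top X)) \<times> carrier (open_frame (neg_top X))"
      using I(1) two_frames.coproduct_idealD(1)[OF two_frames_Omega]
      unfolding Omega_coproduct_def two_frames.carrier_frame_coproduct[OF two_frames_Omega] by blast
    have xc: "Omega_inl X x \<in> carrier (Omega_coproduct X)" "Omega_inr X y \<in> carrier (Omega_coproduct X)"
      if "(x, y) \<in> I" for x y
      using subsetD[OF sub that] frame_mapD(1)[OF frame_map_Omega_inl, of x X]
        frame_mapD(1)[OF frame_map_Omega_inr, of y X] by simp_all
    have e: "?e ` I \<subseteq> carrier (Omega_coproduct X)" using xc by auto
    have "I = \<Squnion>\<^bsub>Omega_coproduct X\<^esub>(?e ` I)"
      using two_frames.frame_coproduct_generated[OF two_frames_Omega[of X]] I(1)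
      unfolding Omega_coproduct_def Omega_inl_def Omega_inr_def by simp
    then have "c = \<Squnion>\<^bsub>total_frame (bOmega_fin X)\<^esub>(q.cls ` ?e ` I)"
      using q.sup_cls[OF e] I(2) by simp
    also have "q.cls ` ?e ` I = (\<lambda>(x, y).
        pos_emb (bOmega_fin X) x \<sqinter>\<^bsub>total_frame (bOmega_fin X)\<^esub> neg_emb (bOmega_fin X) y) ` I"
      unfolding image_image using q.meet_cls xc by (intro image_cong) auto
    finally show ?thesis using sub by blast
  qed
  show ?thesis
    unfolding is_biframe_def
    using frame_total_bOmega_fin[of X] frame_map_pos_emb[of X] frame_map_neg_emb[of X] inj gen
    by (simp add: frame_open_frame)
qed

end

theory Submission
  imports Defs
begin

text \<open>A point of \<open>bOmega_fin X\<close> is a pair \<open>(f, g)\<close> of points of the two frames of opens such that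
  \<open>f U\<close> and \<open>g V\<close> imply \<open>f U'\<close> or \<open>g V'\<close> whenever \<open>U \<inter> V \<subseteq> U' \<union> V'\<close>. Let \<open>P\<close> and \<open>N\<close> be the
  largest opens on which \<open>f\<close> and \<open>g\<close> vanish. The relation \<open>X \<inter> X \<subseteq> P \<union> N\<close> would force \<open>f P\<close> or
  \<open>g N\<close>, so some \<open>x\<close> lies outside \<open>P \<union> N\<close>. If \<open>X\<close> is pairwise Hausdorff, this \<open>x\<close> is unique, since
  the sets \<open>U\<close>, \<open>V\<close> of a separation of two such points would satisfy \<open>f U\<close>, \<open>g V\<close> and
  \<open>U \<inter> V \<subseteq> {} \<union> {}\<close>. Hence \<open>x \<notin> U\<close> implies \<open>U \<inter> X \<subseteq> P \<union> N\<close> and so \<open>\<not> f U\<close>; similarly for \<open>g\<close>.\<close>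

lemma join_two_frame: "a \<squnion>\<^bsub>two_frame\<^esub> b \<longleftrightarrow> a \<or> b"
  by (simp add: join_def sup_two_frame)

lemma le_two_frame: "a \<sqsubseteq>\<^bsub>two_frame\<^esub> b \<longleftrightarrow> (a \<longrightarrow> b)"
  by (auto simp: two_frame_def)

lemma carrier_open_frame: "carrier (open_frame T) = {U. openin T U}"
  by (simp add: open_frame_def)

text \<open>Joins, meets and top become unions, intersections and the whole space, so points can be
  handled by plain set theory. The family \<open>A = {}\<close> is included; it makes
  \<open>f {}\<close> false.\<close>

lemma frame_map_open_two_iff:
  "frame_map (open_frame T) two_frame f \<longleftrightarrow>
    (\<forall>A. (\<forall>U\<in>A. openin T U) \<longrightarrow> f (\<Union>A) = (\<exists>U\<in>A. f U)) \<and>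
    (\<forall>U V. openin T U \<longrightarrow> openin T V \<longrightarrow> f (U \<inter> V) = (f U \<and> f V)) \<and>
    f (topspace T)" (is "?L \<longleftrightarrow> ?R")
proof
  assume f: ?L
  have "f (\<Union>A) = (\<exists>U\<in>A. f U)" if A: "\<forall>U\<in>A. openin T U" for A
  proof -
    have c: "A \<subseteq> carrier (open_frame T)" using A by (auto simp: carrier_open_frame)
    show ?thesis
      using frame_mapD(2)[OF f c] by (simp add: sup_open_frame[OF c] sup_two_frame)
  qed
  moreover have "f (U \<inter> V) = (f U \<and> f V)" if "openin T U" "openin T V" for U V
    using frame_mapD(3)[OF f, of U V] that
    by (simp add: carrier_open_frame meet_open_frame meet_two_frame)
  moreover have "f (topspace T)"
    using frame_mapD(4)[OF f] top_two_frame by (simp add: top_open_frame)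
  ultimately show ?R by blast
next
  assume f: ?R
  show ?L
  proof (rule frame_mapI[OF frame_open_frame frame_two_frame])
    show "f (\<Squnion>\<^bsub>open_frame T\<^esub>A) = \<Squnion>\<^bsub>two_frame\<^esub>(f ` A)" if A: "A \<subseteq> carrier (open_frame T)" for A
      using conjunct1[OF f, rule_format, of A] A
      by (auto simp: sup_open_frame[OF A] sup_two_frame carrier_open_frame)
    show "f (U \<sqinter>\<^bsub>open_frame T\<^esub> V) = f U \<sqinter>\<^bsub>two_frame\<^esub> f V"
      if "U \<in> carrier (open_frame T)" "V \<in> carrier (open_frame T)" for U V
      using conjunct1[OF conjunct2[OF f], rule_format, of U V] that
      by (simp add: carrier_open_frame meet_open_frame meet_two_frame)
    show "f \<top>\<^bsub>open_frame T\<^esub> = \<top>\<^bsub>two_frame\<^esub>"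
      using f top_two_frame by (simp add: top_open_frame)
  qed (simp add: two_frame_def)
qed

text \<open>In the two-element frame a meet lies below a join exactly when this implication holds,
  so these are the inequalities imposed on \<open>bOmega_fin X\<close>, read off at \<open>f\<close>
  and \<open>g\<close>.\<close>

definition finitary_pair :: "'a bispace \<Rightarrow> ('a set \<Rightarrow> bool) \<Rightarrow> ('a set \<Rightarrow> bool) \<Rightarrow> bool" where
  "finitary_pair X f g \<longleftrightarrow>
    (\<forall>U V U' V'. openin (pos_top X) U \<longrightarrow> openin (neg_top X) V \<longrightarrow>
      openin (pos_top X) U' \<longrightarrow> openin (neg_top X) V' \<longrightarrow>
      U \<inter> V \<subseteq> U' \<union> V' \<longrightarrow> f U \<longrightarrow> g V \<longrightarrow> f U' \<or> g V')"

lemma finitary_pairD: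
  assumes "finitary_pair X f g" "openin (pos_top X) U" "openin (neg_top X) V"
    "openin (pos_top X) U'" "openin (neg_top X) V'" "U \<inter> V \<subseteq> U' \<union> V'" "f U" "g V"
  shows "f U' \<or> g V'"
  using assms unfolding finitary_pair_def by blast

text \<open>Eliminates the map \<open>h\<close> on the total frame. The imposed inequalities hold in
  the quotient and any \<open>h\<close> carries them to \<open>f\<close> and \<open>g\<close>;
  conversely, the universal property of coproduct and quotient builds \<open>h\<close> from a pair
  satisfying them.\<close>

lemma bpoints_bOmega_fin_iff:
  "(f, g) \<in> bpoints (bOmega_fin X) \<longleftrightarrow>
    f \<in> extensional {U. openin (pos_top X) U} \<and> g \<in> extensional {V. openin (neg_top X) V} \<and>
    frame_map (open_frame (pos_top X)) two_frame f \<and>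
    frame_map (open_frame (neg_top X)) two_frame g \<and> finitary_pair X f g" (is "?L \<longleftrightarrow> ?R")
proof
  assume ?L
  then obtain h where h: "frame_map (total_frame (bOmega_fin X)) two_frame h"
    and hp: "\<And>U. openin (pos_top X) U \<Longrightarrow> h (pos_emb (bOmega_fin X) U) = f U"
    and hn: "\<And>V. openin (neg_top X) V \<Longrightarrow> h (neg_emb (bOmega_fin X) V) = g V"
    and r: "f \<in> extensional {U. openin (pos_top X) U}" "g \<in> extensional {V. openin (neg_top X) V}"
      "frame_map (open_frame (pos_top X)) two_frame f"
      "frame_map (open_frame (neg_top X)) two_frame g"
    unfolding bpoints_def biframe_map_def two_biframe_def
    by (auto simp del: bOmega_fin_sel(3-5) simp: carrier_open_frame)
  interpret t: frame "total_frame (bOmega_fin X)" by (rule frame_total_bOmega_fin)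
  have "f U' \<or> g V'"
    if o: "openin (pos_top X) U" "openin (neg_top X) V" "openin (pos_top X) U'"
      "openin (neg_top X) V'" "U \<inter> V \<subseteq> U' \<union> V'" and fg: "f U" "g V" for U V U' V'
  proof -
    let ?p = "pos_emb (bOmega_fin X)" and ?n = "neg_emb (bOmega_fin X)"
    let ?T = "total_frame (bOmega_fin X)"
    have c: "?p U \<in> carrier ?T" "?p U' \<in> carrier ?T" "?n V \<in> carrier ?T" "?n V' \<in> carrier ?T"
      using o frame_mapD(1)[OF frame_map_pos_emb] frame_mapD(1)[OF frame_map_neg_emb]
      unfolding openin_carrier by blast+
    have "h (?p U \<sqinter>\<^bsub>?T\<^esub> ?n V) \<sqsubseteq>\<^bsub>two_frame\<^esub> h (?p U' \<squnion>\<^bsub>?T\<^esub> ?n V')"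
      by (rule frame_map_mono[OF h t.frame_axioms frame_two_frame _ _ bOmega_fin_relation[OF o]])
        (use c in \<open>auto intro: t.meet_closed t.join_closed simp del: bOmega_fin_sel\<close>)
    then show ?thesis
      using fg o c by (simp add: frame_mapD(3)[OF h] frame_map_join[OF h] hp hn
          meet_two_frame join_two_frame le_two_frame del: bOmega_fin_sel)
  qed
  then show ?R using r unfolding finitary_pair_def by blast
next
  assume r: ?R
  have "\<exists>h. frame_map (total_frame (bOmega_fin X)) two_frame h \<and>
    (\<forall>U. openin (pos_top X) U \<longrightarrow> h (pos_emb (bOmega_fin X) U) = f U) \<and>
    (\<forall>V. openin (neg_top X) V \<longrightarrow> h (neg_emb (bOmega_fin X) V) = g V)"
    by (rule bOmega_fin_universal[OF frame_two_frame])
      (use r finitary_pairD[of X f g] in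
        \<open>auto simp: meet_two_frame join_two_frame le_two_frame\<close>)
  then show ?L
    using r unfolding bpoints_def biframe_map_def two_biframe_def
    by (auto simp del: bOmega_fin_sel(3-5) simp: carrier_open_frame)
qed

lemma neighbourhood_point_in_bpoints:
  assumes "is_bispace X" "x \<in> topspace (pos_top X)"
  shows "neighbourhood_point X x \<in> bpoints (bOmega_fin X)"
proof -
  have "topspace (neg_top X) = topspace (pos_top X)" using assms(1) by (simp add: is_bispace_def)
  then show ?thesis
    using assms(2) openin_topspace[of "pos_top X"] openin_topspace[of "neg_top X"]
    unfolding neighbourhood_point_def bpoints_bOmega_fin_iff frame_map_open_two_iff
      finitary_pair_def
    by (auto simp del: openin_topspace)
qed

text \<open>The core of surjectivity. Agreement is claimed on opens only, because \<open>f\<close>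
  and \<open>g\<close> are unconstrained on other sets.\<close>

lemma finitary_pair_eq_neighbourhoods:
  assumes X: "is_bispace X" "pairwise_hausdorff X"
    and f: "frame_map (open_frame (pos_top X)) two_frame f"
    and g: "frame_map (open_frame (neg_top X)) two_frame g"
    and fg: "finitary_pair X f g"
  obtains x where "x \<in> topspace (pos_top X)"
    "\<And>U. openin (pos_top X) U \<Longrightarrow> f U \<longleftrightarrow> x \<in> U"
    "\<And>V. openin (neg_top X) V \<Longrightarrow> g V \<longleftrightarrow> x \<in> V"
proof -
  have ts: "topspace (neg_top X) = topspace (pos_top X)" using X(1) by (simp add: is_bispace_def)
  note f = f[unfolded frame_map_open_two_iff] and g = g[unfolded frame_map_open_two_iff]
  define P where "P = \<Union>{U. openin (pos_top X) U \<and> \<not> f U}"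
  define N where "N = \<Union>{V. openin (neg_top X) V \<and> \<not> g V}"
  have o: "openin (pos_top X) P" "openin (neg_top X) N" unfolding P_def N_def by blast+
  \<comment> \<open>Preservation of unions: a union of opens with value false has value
    false.\<close>
  have v: "\<not> f P" "\<not> g N"
    using conjunct1[OF f, rule_format, of "{U. openin (pos_top X) U \<and> \<not> f U}"]
      conjunct1[OF g, rule_format, of "{V. openin (neg_top X) V \<and> \<not> g V}"]
    unfolding P_def N_def by blast+
  have e: "\<not> f {}" "\<not> g {}"
    using conjunct1[OF f, rule_format, of "{}"] conjunct1[OF g, rule_format, of "{}"] by auto
  have top: "f (topspace (pos_top X))" "g (topspace (pos_top X))" using f g ts by auto
  have oX: "openin (neg_top X) (topspace (pos_top X))" using ts by (metis openin_topspace)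
  \<comment> \<open>Used twice: with the whole space on both sides it produces \<open>x\<close>, and
    with the whole space on one side it locates \<open>x\<close> in a given open.\<close>
  have cover: "\<not> U \<inter> V \<subseteq> P \<union> N"
    if "openin (pos_top X) U" "openin (neg_top X) V" "f U" "g V" for U V
    using finitary_pairD[OF fg that(1,2) o _ that(3,4)] v by blast
  obtain x where x: "x \<in> topspace (pos_top X)" "x \<notin> P" "x \<notin> N"
    using cover[OF openin_topspace oX top] by blast
  have pos: "f U" if "openin (pos_top X) U" "y \<in> U" "y \<notin> P" for U y
    using that unfolding P_def by blast
  have neg: "g V" if "openin (neg_top X) V" "y \<in> V" "y \<notin> N" for V y
    using that unfolding N_def by blast
  have unique: "y = x" if y: "y \<in> topspace (pos_top X)" "y \<notin> P" "y \<notin> N" for y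
  proof (rule ccontr)
    assume "y \<noteq> x"
    then obtain U V where UV: "openin (pos_top X) U" "openin (neg_top X) V" "disjnt U V"
      "x \<in> U \<and> y \<in> V \<or> y \<in> U \<and> x \<in> V"
      using X(2) x(1) y(1) unfolding pairwise_hausdorff_def by metis
    \<comment> \<open>Both points avoid \<open>P\<close> and \<open>N\<close>, so it does not matter
      which of them lies in \<open>U\<close> and which in \<open>V\<close>.\<close>
    have "f U" "g V" using UV x y pos neg by blast+
    then show False
      using finitary_pairD[OF fg UV(1,2) openin_empty openin_empty] UV(3) e
      by (auto simp: disjnt_def)
  qed
  show thesis
  proof (rule that[OF x(1)])
    \<comment> \<open>If \<open>f U\<close> holds, \<open>cover\<close> yields a point of
      \<open>U\<close> outside \<open>P \<union> N\<close>, which must be \<open>x\<close> by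
      uniqueness; the converse is \<open>pos\<close>.\<close>
    show "f U \<longleftrightarrow> x \<in> U" if U: "openin (pos_top X) U" for U
      using cover[OF U oX _ top(2)] unique pos[OF U] x by blast
    show "g V \<longleftrightarrow> x \<in> V" if V: "openin (neg_top X) V" for V
      using cover[OF openin_topspace V top(1)] unique neg[OF V] x by blast
  qed
qed

text \<open>In either alternative of the separation, disjointness makes the positive open contain
  exactly one of the two points.\<close>

lemma inj_on_neighbourhood_point:
  assumes "pairwise_hausdorff X"
  shows "inj_on (neighbourhood_point X) (topspace (pos_top X))"
proof (rule inj_onI, rule ccontr)
  fix x y
  assume xy: "x \<in> topspace (pos_top X)" "y \<in> topspace (pos_top X)" "x \<noteq> y"
    and eq: "neighbourhood_point X x = neighbourhood_point X y"
  have "x \<in> U \<longleftrightarrow> y \<in> U" if "openin (pos_top X) U" for U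
    using fun_cong[OF arg_cong[OF eq, of fst], of U] that by (simp add: neighbourhood_point_def)
  moreover have "x \<in> V \<longleftrightarrow> y \<in> V" if "openin (neg_top X) V" for V
    using fun_cong[OF arg_cong[OF eq, of snd], of V] that by (simp add: neighbourhood_point_def)
  ultimately show False
    using assms xy unfolding pairwise_hausdorff_def disjnt_iff by metis
qed

lemma neighbourhood_point_image:
  assumes "is_bispace X" "pairwise_hausdorff X"
  shows "neighbourhood_point X ` topspace (pos_top X) = bpoints (bOmega_fin X)"
proof
  show "neighbourhood_point X ` topspace (pos_top X) \<subseteq> bpoints (bOmega_fin X)"
    using neighbourhood_point_in_bpoints[OF assms(1)] by blast
  show "bpoints (bOmega_fin X) \<subseteq> neighbourhood_point X ` topspace (pos_top X)"
  proof
    fix p assume p: "p \<in> bpoints (bOmega_fin X)"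
    obtain f g where fg: "p = (f, g)" by fastforce
    note r = p[unfolded fg bpoints_bOmega_fin_iff]
    obtain x where x: "x \<in> topspace (pos_top X)"
      "\<And>U. openin (pos_top X) U \<Longrightarrow> f U \<longleftrightarrow> x \<in> U"
      "\<And>V. openin (neg_top X) V \<Longrightarrow> g V \<longleftrightarrow> x \<in> V"
      using finitary_pair_eq_neighbourhoods[OF assms, of f g] r by blast
    \<comment> \<open>Both sides are extensional, so agreement on opens suffices.\<close>
    have "neighbourhood_point X x = p"
      unfolding fg neighbourhood_point_def
      using r x(2,3) by (auto intro!: extensionalityI[of _ "Collect _"])
    then show "p \<in> neighbourhood_point X ` topspace (pos_top X)" using x(1) by blast
  qed
qed

lemma homeomorphic_map_if_opens_are_images:
  assumes bij: "bij_betw \<phi> (topspace S) (topspace T)"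
    and opens: "\<And>W. openin T W \<longleftrightarrow> (\<exists>U. openin S U \<and> W = \<phi> ` U)"
  shows "homeomorphic_map S T \<phi>"
proof (rule bijective_open_imp_homeomorphic_map)
  show surj: "\<phi> ` topspace S = topspace T" and inj: "inj_on \<phi> (topspace S)"
    using bij by (simp_all add: bij_betw_def)
  show "continuous_map S T \<phi>"
    unfolding continuous_map
  proof (intro conjI allI impI)
    fix W assume "openin T W"
    then obtain U where U: "openin S U" "W = \<phi> ` U" using opens by auto
    have "{x \<in> topspace S. \<phi> x \<in> W} = U"
      using inj_on_image_mem_iff[OF inj _ openin_subset[OF U(1)]] openin_subset[OF U(1)]
      unfolding U(2) by auto
    then show "openin S {x \<in> topspace S. \<phi> x \<in> W}" using U(1) by simp
  qed (simp add: surj)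
  show "open_map S T \<phi>" by (auto simp: open_map_def opens)
qed

theorem lemma3p31:
  fixes X :: "'a bispace"
  assumes "is_bispace X"
    and "pairwise_hausdorff X"
  shows "bisober X"
proof -
  let ?B = "bOmega_fin X"
  note X = assms
  have f: "frame (pos_frame ?B)" "frame (neg_frame ?B)" by (simp_all add: frame_open_frame)
  have ts: "topspace (neg_top X) = topspace (pos_top X)" using X(1) by (simp add: is_bispace_def)
  note image = neighbourhood_point_image[OF X]
  have bij: "bij_betw (neighbourhood_point X) (topspace (pos_top X)) (bpoints ?B)"
    using inj_on_neighbourhood_point[OF X(2)] image by (simp add: bij_betw_def)
  \<comment> \<open>Every point is some \<open>neighbourhood_point X x\<close>, whose value at
    \<open>U\<close> is \<open>x \<in> U\<close>. So the opens of \<open>bpt\<close> are exactly the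
    images of opens.\<close>
  have pos: "neighbourhood_point X ` U = {p \<in> bpoints ?B. fst p U}" if "openin (pos_top X) U" for U
    unfolding image[symmetric] using that openin_subset[OF that]
    by (auto simp: neighbourhood_point_def)
  have neg: "neighbourhood_point X ` V = {p \<in> bpoints ?B. snd p V}" if "openin (neg_top X) V" for V
    unfolding image[symmetric] using that openin_subset[OF that] ts
    by (auto simp: neighbourhood_point_def)
  have "homeomorphic_map (pos_top X) (pos_top (bpt ?B)) (neighbourhood_point X)"
    by (rule homeomorphic_map_if_opens_are_images)
      (use bij pos in \<open>auto simp: topspace_bpt[OF f] openin_pos_bpt[OF f(1)] carrier_open_frame\<close>)
  moreover have "homeomorphic_map (neg_top X) (neg_top (bpt ?B)) (neighbourhood_point X)"
    by (rule homeomorphic_map_if_opens_are_images)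
      (use bij neg ts in \<open>auto simp: topspace_bpt[OF f] openin_neg_bpt[OF f(2)] carrier_open_frame\<close>)
  ultimately show ?thesis by (simp add: bisober_def bihomeomorphism_def)
qed

end
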